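(* Fix integers $1\le i<s\le t\le r$. For $n\ge r$ let $N(n)$ be the maximum of $k^t(\mathcal H)$ over all $s$-graphs $\mathcal H$ on $n$ vertices with $\Delta_i(\mathcal H)\le\binom{r-i}{s-i}$. Then \[N(n)=(1-o(1))\frac{\binom{n}{i}}{\binom{r}{i}}\binom{r}{t}\quad\text{as } n\to\infty.\]
   Context: An $s$-graph is a family of $s$-subsets (edges) of a vertex set. For $|I|=i$, $d_{\mathcal H}(I)$ is the number of edges containing $I$ and $\Delta_i(\mathcal H)=\max_{|I|=i}d_{\mathcal H}(I)$. $k^t(\mathcal H)$ is the number of $t$-sets all of whose $s$-subsets are edges. *)

theory Defs
  imports Complex_Main
begin

definition sgraph :: "nat \<Rightarrow> nat \<Rightarrow> nat set set \<Rightarrow> bool" where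
  "sgraph n s H \<longleftrightarrow> (\<forall>e\<in>H. e \<subseteq> {..<n} \<and> card e = s)"

definition deg :: "nat set set \<Rightarrow> nat set \<Rightarrow> nat" where
  "deg H I = card {e\<in>H. I \<subseteq> e}"

definition Delta :: "nat \<Rightarrow> nat \<Rightarrow> nat set set \<Rightarrow> nat" where
  "Delta n i H = Max {deg H I | I. I \<subseteq> {..<n} \<and> card I = i}"

definition kt :: "nat \<Rightarrow> nat \<Rightarrow> nat \<Rightarrow> nat set set \<Rightarrow> nat" where
  "kt n s t H = card {T. T \<subseteq> {..<n} \<and> card T = t \<and>
                      (\<forall>S. S \<subseteq> T \<and> card S = s \<longrightarrow> S \<in> H)}"

definition Nmax :: "nat \<Rightarrow> nat \<Rightarrow> nat \<Rightarrow> nat \<Rightarrow> nat \<Rightarrow> nat" where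
  "Nmax i s t r n = Max {kt n s t H | H. sgraph n s H \<and> Delta n i H \<le> (r - i) choose (s - i)}"

end

theory Submission
  imports Defs "HOL-Analysis.Analysis"
begin

text \<open>The upper bound counts pairs of an \<open>i\<close>-set inside a \<open>t\<close>-clique: the cliques containing a given
  \<open>i\<close>-set are \<open>(t - i)\<close>-cliques in its link, an \<open>(s - i)\<close>-graph with at most
  \<open>(r - i) choose (s - i)\<close> edges, and are bounded by the Kruskal--Katona theorem.
  For the lower bound take all \<open>s\<close>-subsets of the members of an asymptotically optimal packing of
  \<open>r\<close>-sets, no two of which share an \<open>i\<close>-set. Such packings are Roedl's theorem; it follows from
  the nibble for regular hypergraphs with small codegrees: repeatedly draw a small random batch of
  edges and delete all vertices they cover. First and second moments suffice to show that the
  remaining hypergraph stays nearly regular in the \<open>L\<^sup>1\<close> sense.\<close>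

section \<open>One round of the nibble\<close>

text \<open>A standard nibble keeps every single degree near its mean by concentration bounds. Here
  only the sum of |degree - \<open>d\<close>| over all vertices is kept small. This is enough
  because deleting vertices never raises a degree: the degree \<open>D n\<close> of the initial
  regular hypergraph stays an upper bound in every round, so few bad vertices can spoil only few
  edges. The variance bounds give L2 control after a round, and Cauchy-Schwarz turns it into the L1
  control that the next round requires. The number of rounds is fixed before n grows, so each error
  need only be o(1) and no rates are tracked. Kruskal-Katona is used with a real parameter, since
  the degrees met in its induction need not be binomial coefficients. The two bounds on N(n) agree
  because C(r,i) C(r-i,t-i) = C(r,t) C(t,i): an i-set inside a packed r-set attains the local clique
  bound, and the packing misses only a vanishing fraction of the i-sets.\<close>

definition mean :: "'b set \<Rightarrow> ('b \<Rightarrow> real) \<Rightarrow> real" where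
  "mean L f = (\<Sum>x\<in>L. f x) / card L"

lemma mean_add: "mean L (\<lambda>x. f x + g x) = mean L f + mean L g"
  by (simp add: mean_def sum.distrib add_divide_distrib)

lemma mean_diff: "mean L (\<lambda>x. f x - g x) = mean L f - mean L g"
  by (simp add: mean_def sum_subtractf diff_divide_distrib)

lemma mean_cmult: "mean L (\<lambda>x. c * f x) = c * mean L f"
  by (simp add: mean_def sum_distrib_left)

lemma mean_sum: "mean L (\<lambda>x. \<Sum>a\<in>A. f a x) = (\<Sum>a\<in>A. mean L (f a))"
  by (simp add: mean_def sum.swap[of _ A] sum_divide_distrib)

lemma mean_const: "finite L \<Longrightarrow> L \<noteq> {} \<Longrightarrow> mean L (\<lambda>x. c) = c"
  by (simp add: mean_def)

lemma exists_le_mean: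
  assumes "finite L" "L \<noteq> {}"
  shows "\<exists>x\<in>L. f x \<le> mean L f"
proof (rule ccontr)
  assume "\<not> ?thesis"
  then have "(\<Sum>x\<in>L. mean L f) < (\<Sum>x\<in>L. f x)"
    using assms by (intro sum_strict_mono) (auto simp: not_le)
  then show False using assms by (simp add: mean_def card_gt_0_iff)
qed

definition vdeg :: "'a set set \<Rightarrow> 'a \<Rightarrow> nat" where
  "vdeg F v = card {e\<in>F. v \<in> e}"

definition codeg :: "'a set set \<Rightarrow> 'a \<Rightarrow> 'a \<Rightarrow> nat" where
  "codeg F u v = card {e\<in>F. u \<in> e \<and> v \<in> e}"

definition alive :: "'a set \<Rightarrow> 'a set list \<Rightarrow> real" where
  "alive S xs = of_bool (S \<inter> \<Union>(set xs) = {})"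

text \<open>One round: \<open>m\<close> edges of \<open>F\<close> are drawn uniformly with repetition, so that a set \<open>S\<close> of
  vertices is missed with probability exactly \<open>(1 - h / card F) ^ m\<close>, where \<open>h\<close> edges meet \<open>S\<close>.
  Most degrees are close to \<open>d\<close>, all are at most \<open>D\<close>, and \<open>y\<close> is the approximate survival
  probability of a vertex.\<close>

locale nibble_round =
  fixes W :: "'a set" and F :: "'a set set" and k m :: nat and d D C y K w :: real
  assumes finW: "finite W" and FW: "\<And>e. e \<in> F \<Longrightarrow> e \<subseteq> W \<and> card e = k" and k_pos: "k > 0"
    and F_ne: "F \<noteq> {}"
    and deg_le: "\<And>v. v \<in> W \<Longrightarrow> real (vdeg F v) \<le> D"
    and codeg_le: "\<And>u v. u \<in> W \<Longrightarrow> v \<in> W \<Longrightarrow> u \<noteq> v \<Longrightarrow> real (codeg F u v) \<le> C"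
    and d: "0 \<le> d" "d \<le> D" and D: "D > 0" and C: "C \<ge> 0" and y: "0 \<le> y" "y \<le> 1"
    and K: "m * D \<le> K * card F"
    and small: "2 * k * d \<le> card F"
    and w: "\<And>j. j \<le> 2 * k \<Longrightarrow> \<bar>(1 - j * d / card F) ^ m - y ^ j\<bar> \<le> w"
begin

abbreviation "M \<equiv> card F"
definition "L = {xs. set xs \<subseteq> F \<and> length xs = m}"
definition "q S = mean L (alive S)"
definition "g v = \<bar>real (vdeg F v) - d\<bar>"
definition "G = (\<Sum>v\<in>W. g v)"
text \<open>The error in a survival probability that does not depend on the degrees:
  \<open>w\<close> comes from replacing the m-th power by a power of \<open>y\<close>, the other
  term from edges meeting a set of at most 2k vertices more than once. \<open>K\<close> bounds the
  expected number of drawn edges through a vertex.\<close>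

definition "\<theta> = w + 4 * k\<^sup>2 * K * C / D"

lemma finF: "finite F"
  by (rule finite_subset[of _ "Pow W"]) (use FW finW in auto)

lemma M_pos: "M > 0" using finF F_ne by (simp add: card_gt_0_iff)

lemma fin_edge: "e \<in> F \<Longrightarrow> finite e"
  using FW finW finite_subset by blast

lemma finL: "finite L" and cardL: "card L = M ^ m"
  using finite_lists_length_eq[OF finF, of m] card_lists_length_eq[OF finF, of m]
  by (auto simp: L_def)

lemma L_ne: "L \<noteq> {}" using cardL M_pos by fastforce

lemma K_nonneg: "K \<ge> 0"
proof -
  have "0 \<le> K * M" using K D by (meson order.trans mult_nonneg_nonneg of_nat_0_le_iff less_imp_le)
  then show ?thesis using M_pos by (simp add: zero_le_mult_iff)
qed

lemma w_nonneg: "w \<ge> 0" using w[of 0] by linarith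

lemma \<theta>_nonneg: "\<theta> \<ge> 0"
  unfolding \<theta>_def using w_nonneg K_nonneg C D by simp

lemma g_nonneg: "g v \<ge> 0" by (simp add: g_def)
lemma g_le: "v \<in> W \<Longrightarrow> g v \<le> D"
  using deg_le[of v] d by (auto simp: g_def)

section \<open>Survival probabilities of small vertex sets\<close>

lemma q_eq: "q S = (1 - card {e\<in>F. e \<inter> S \<noteq> {}} / M) ^ m"
proof -
  have s: "{e\<in>F. e \<inter> S = {}} = F - {e\<in>F. e \<inter> S \<noteq> {}}" by auto
  have c: "real (card {e\<in>F. e \<inter> S = {}}) = M - real (card {e\<in>F. e \<inter> S \<noteq> {}})"
    unfolding s using finF by (subst card_Diff_subset) (auto intro!: of_nat_diff card_mono)
  have "(\<Sum>xs\<in>L. alive S xs) = card {xs\<in>L. S \<inter> \<Union>(set xs) = {}}"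
    unfolding alive_def using finL by (simp add: sum.If_cases of_bool_def Int_def)
  also have "{xs\<in>L. S \<inter> \<Union>(set xs) = {}} = {xs. set xs \<subseteq> {e\<in>F. e \<inter> S = {}} \<and> length xs = m}"
    unfolding L_def by blast
  also have "card \<dots> = card {e\<in>F. e \<inter> S = {}} ^ m"
    using finF by (intro card_lists_length_eq) auto
  finally show ?thesis
    unfolding q_def mean_def cardL using M_pos
    by (simp add: c power_divide[symmetric] diff_divide_distrib)
qed

lemma hit_le: "real (card {e\<in>F. e \<inter> S \<noteq> {}}) \<le> M"
  using finF by (auto intro!: card_mono)

lemma q_bounds: "0 \<le> q S" "q S \<le> 1"
  unfolding q_eq using hit_le[of S] M_pos by (auto intro!: zero_le_power power_le_one)

text \<open>The sum of degrees overcounts only edges with two vertices in \<open>S\<close>, and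
  codegrees bound these. In the induction the new vertex shares at most |S| C edges with the old
  ones, and |S|^2 + |S| is at most (|S| + 1)^2.\<close>

lemma hit_card:
  assumes "finite S" "S \<subseteq> W"
  shows "\<bar>real (card {e\<in>F. e \<inter> S \<noteq> {}}) - (\<Sum>u\<in>S. real (vdeg F u))\<bar> \<le> (card S)\<^sup>2 * C"
  using assms
proof (induction S rule: finite_induct)
  case empty
  then show ?case by simp
next
  case (insert u S)
  let ?A = "{e\<in>F. e \<inter> S \<noteq> {}}" and ?B = "{e\<in>F. u \<in> e}"
  have un: "{e\<in>F. e \<inter> insert u S \<noteq> {}} = ?B \<union> ?A" by auto
  have ca: "real (card ?B) + card ?A = card (?B \<union> ?A) + real (card (?B \<inter> ?A))"
    using card_Un_Int[of ?B ?A] finF by (simp flip: of_nat_add)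
  have "card (?B \<inter> ?A) \<le> card (\<Union>v\<in>S. {e\<in>F. u \<in> e \<and> v \<in> e})"
    by (intro card_mono finite_UN_I insert) (use finF in auto)
  also have "\<dots> \<le> (\<Sum>v\<in>S. codeg F u v)"
    unfolding codeg_def by (rule card_UN_le) fact
  finally have "real (card (?B \<inter> ?A)) \<le> (\<Sum>v\<in>S. real (codeg F u v))"
    unfolding of_nat_sum[symmetric] of_nat_le_iff .
  also have "\<dots> \<le> (\<Sum>v\<in>S. C)"
    using insert by (intro sum_mono codeg_le) auto
  also have "\<dots> = card S * C" by simp
  finally have i: "real (card (?B \<inter> ?A)) \<le> card S * C" .
  have IH: "\<bar>real (card ?A) - (\<Sum>u\<in>S. real (vdeg F u))\<bar> \<le> (card S)\<^sup>2 * C"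
    using insert by simp
  have "\<bar>real (card (?B \<union> ?A)) - (vdeg F u + (\<Sum>u\<in>S. real (vdeg F u)))\<bar> \<le> (card S)\<^sup>2 * C + card S * C"
    using ca i IH unfolding vdeg_def by linarith
  also have "\<dots> \<le> (card (insert u S))\<^sup>2 * C"
    using insert C by (simp add: power2_eq_square algebra_simps)
  finally show ?case using insert unfolding un by simp
qed

text \<open>Sets of up to 2k vertices are needed because second moments of degrees involve unions of
  two edges. Degree deviations enter only linearly, which is why L1 control of them
  suffices.\<close>

lemma q_approx:
  assumes "S \<subseteq> W" "card S \<le> 2 * k"
  shows "\<bar>q S - y ^ card S\<bar> \<le> \<theta> + K / D * (\<Sum>u\<in>S. g u)"
proof -
  have fS: "finite S" using assms finW finite_subset by blast
  let ?h = "real (card {e\<in>F. e \<inter> S \<noteq> {}})"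
  let ?b = "1 - card S * d / M"
  have jd: "card S * d \<le> M"
  proof -
    have "card S * d \<le> (2 * k) * d" using assms d by (intro mult_right_mono) auto
    then show ?thesis using small by simp
  qed
  have "\<bar>(\<Sum>u\<in>S. real (vdeg F u)) - card S * d\<bar> = \<bar>\<Sum>u\<in>S. (real (vdeg F u) - d)\<bar>"
    by (simp add: sum_subtractf)
  also have "\<dots> \<le> (\<Sum>u\<in>S. g u)" unfolding g_def by (rule sum_abs)
  finally have "\<bar>?h - card S * d\<bar> \<le> (\<Sum>u\<in>S. g u) + (card S)\<^sup>2 * C"
    using hit_card[OF fS assms(1)] by linarith
  also have "(card S)\<^sup>2 * C \<le> (2 * k)\<^sup>2 * C" using assms C
    by (intro mult_right_mono of_nat_mono power_mono) auto
  finally have h: "\<bar>?h - card S * d\<bar> \<le> (\<Sum>u\<in>S. g u) + 4 * k\<^sup>2 * C"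
    by (simp add: power_mult_distrib)
  \<comment> \<open>For a, b in [0,1] the m-th powers differ by at most m |a - b|; the assumption
    \<open>small\<close> puts \<open>?b\<close> in this range.\<close>
  have "\<bar>q S - ?b ^ m\<bar> \<le> m * \<bar>(1 - ?h / M) - ?b\<bar>"
    unfolding q_eq using norm_power_diff[of "1 - ?h / M" ?b m] hit_le[of S] M_pos jd d by simp
  also have "\<bar>(1 - ?h / M) - ?b\<bar> = \<bar>?h - card S * d\<bar> / M"
    using M_pos by (simp add: diff_divide_distrib[symmetric] abs_minus_commute)
  also have "m * (\<bar>?h - card S * d\<bar> / M) = m / M * \<bar>?h - card S * d\<bar>" by simp
  also have "\<dots> \<le> K / D * ((\<Sum>u\<in>S. g u) + 4 * k\<^sup>2 * C)"
  proof (rule mult_mono[OF _ h])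
    show "m / M \<le> K / D" using K M_pos D by (simp add: field_simps)
  qed (use K_nonneg D in auto)
  finally have "\<bar>q S - ?b ^ m\<bar> \<le> K / D * (\<Sum>u\<in>S. g u) + 4 * k\<^sup>2 * K * C / D"
    by (simp add: algebra_simps)
  then show ?thesis using w[OF assms(2)] unfolding \<theta>_def by linarith
qed


section \<open>Second moments of the survivor count and of the new degrees\<close>

lemma mean_alive: "mean L (alive S) = q S" by (simp add: q_def)

lemma alive_Un: "alive (S \<union> T) xs = alive S xs * alive T xs"
  by (auto simp: alive_def)

lemma mean_survivors:
  "mean L (\<lambda>xs. (real (card (W - \<Union>(set xs))) - y * card W)\<^sup>2)
    \<le> 3 * \<theta> * (card W)\<^sup>2 + 4 * K / D * card W * G + card W"
proof -
  have expand: "(real (card (W - \<Union>(set xs))) - y * card W)\<^sup>2 =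
      (\<Sum>u\<in>W. \<Sum>v\<in>W. alive {u, v} xs - y * alive {u} xs - y * alive {v} xs + y\<^sup>2)" for xs
  proof -
    have "real (card (W - \<Union>(set xs))) = (\<Sum>v\<in>W. alive {v} xs)"
      unfolding alive_def using finW by (simp add: sum.If_cases of_bool_def Diff_eq Int_def)
    then have "real (card (W - \<Union>(set xs))) - y * card W = (\<Sum>v\<in>W. alive {v} xs - y)"
      by (simp add: sum_subtractf)
    then have "(real (card (W - \<Union>(set xs))) - y * card W)\<^sup>2 =
       (\<Sum>u\<in>W. \<Sum>v\<in>W. (alive {u} xs - y) * (alive {v} xs - y))"
      by (simp add: power2_eq_square sum_product)
    moreover have "(alive {u} xs - y) * (alive {v} xs - y) =
        alive {u, v} xs - y * alive {u} xs - y * alive {v} xs + y\<^sup>2" for u v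
      using alive_Un[of "{u}" "{v}" xs] by (simp add: algebra_simps power2_eq_square insert_commute)
    ultimately show ?thesis by simp
  qed
  \<comment> \<open>With each \<open>q\<close> replaced by its power of \<open>y\<close> the left
    side is y^2 - 2 y^2 + y^2 = 0, so only approximation errors remain. For u = v nothing cancels,
    and the trivial bound 1 produces the final summand \<open>card W\<close>.\<close>
  have pair: "q {u, v} - y * q {u} - y * q {v} + y\<^sup>2
      \<le> 3 * \<theta> + 2 * (K / D) * (g u + g v) + of_bool (u = v)" if "u \<in> W" "v \<in> W" for u v
  proof (cases "u = v")
    case True
    have "0 \<le> \<theta>" "0 \<le> (K / D) * (g u + g v)"
      using \<theta>_nonneg K_nonneg D g_nonneg by simp_all
    moreover have "q {u} - y * q {u} - y * q {u} + y\<^sup>2 \<le> 1"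
    proof -
      have "q {u} - y * q {u} - y * q {u} + y\<^sup>2 = q {u} * (1 - y) * (1 - y) + y\<^sup>2 * (1 - q {u})"
        by (simp add: algebra_simps power2_eq_square)
      also have "\<dots> \<le> q {u} * 1 * 1 + 1 * (1 - q {u})"
        using q_bounds[of "{u}"] y by (intro add_mono mult_mono power_le_one) auto
      finally show ?thesis by simp
    qed
    ultimately show ?thesis using True by simp
  next
    case False
    have k2: "2 \<le> 2 * k" using k_pos by simp
    have "\<bar>q {u, v} - y\<^sup>2\<bar> \<le> \<theta> + K / D * (g u + g v)"
      using q_approx[of "{u, v}"] that k2 False by (simp add: numeral_2_eq_2)
    then have 1: "q {u, v} - y\<^sup>2 \<le> \<theta> + K / D * (g u + g v)" by linarith
    have "\<bar>q {x} - y\<bar> \<le> \<theta> + K / D * g x" if "x \<in> W" for x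
      using q_approx[of "{x}"] that k2 by simp
    then have 2: "y - q {u} \<le> \<theta> + K / D * g u" "y - q {v} \<le> \<theta> + K / D * g v"
      using that by (smt (verit))+
    have nn: "0 \<le> \<theta> + K / D * g x" for x using \<theta>_nonneg K_nonneg D g_nonneg by simp
    have "y * (y - q {u}) \<le> 1 * (\<theta> + K / D * g u)" "y * (y - q {v}) \<le> 1 * (\<theta> + K / D * g v)"
      using mult_left_mono[OF 2(1) y(1)] mult_left_mono[OF 2(2) y(1)]
        mult_right_mono[OF y(2) nn[of u]] mult_right_mono[OF y(2) nn[of v]] by linarith+
    moreover have "q {u, v} - y * q {u} - y * q {v} + y\<^sup>2 =
        (q {u, v} - y\<^sup>2) + y * (y - q {u}) + y * (y - q {v})"
      by (simp add: algebra_simps power2_eq_square)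
    moreover have "of_bool (u = v) = (0::real)" using False by simp
    ultimately show ?thesis using 1 by (simp only: distrib_left)
  qed
  have "mean L (\<lambda>xs. (real (card (W - \<Union>(set xs))) - y * card W)\<^sup>2)
      = (\<Sum>u\<in>W. \<Sum>v\<in>W. q {u, v} - y * q {u} - y * q {v} + y\<^sup>2)"
    unfolding expand mean_sum mean_add mean_diff mean_cmult mean_const[OF finL L_ne] mean_alive ..
  also have "\<dots> \<le> (\<Sum>u\<in>W. \<Sum>v\<in>W. 3 * \<theta> + 2 * (K / D) * (g u + g v) + of_bool (u = v))"
    by (intro sum_mono pair)
  also have "\<dots> = 3 * \<theta> * (card W)\<^sup>2 + 4 * K / D * card W * G + card W"
  proof -
    have "(\<Sum>v\<in>W. of_bool (u = v)) = (1::real)" if "u \<in> W" for u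
      using that finW by (simp add: of_bool_def)
    then have "(\<Sum>u\<in>W. \<Sum>v\<in>W. of_bool (u = v)) = real (card W)" by simp
    then show ?thesis
      by (simp only: sum.distrib sum_distrib_left[symmetric] G_def[symmetric] sum_constant)
        (simp add: algebra_simps power2_eq_square add_divide_distrib)
  qed
  finally show ?thesis .
qed

text \<open>A second moment again, now over pairs of edges at \<open>v\<close>. The main term no
  longer vanishes, since the degree of \<open>v\<close> may differ from \<open>d\<close>; it is at
  most (deg - d)^2, hence at most D times the deviation \<open>g v\<close>.\<close>

lemma mean_degree_at:
  assumes v: "v \<in> W"
  shows "mean L (\<lambda>xs. of_bool (v \<notin> \<Union>(set xs)) *
      (real (vdeg {e\<in>F. e \<inter> \<Union>(set xs) = {}} v) - d * y ^ (k - 1))\<^sup>2)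
    \<le> 4 * D\<^sup>2 * \<theta> + D * k * C + (K + 1) * D * g v + 4 * K * (\<Sum>e\<in>{e\<in>F. v \<in> e}. \<Sum>u\<in>e. g u)"
proof -
  define E where "E = {e\<in>F. v \<in> e}"
  define d1 where "d1 = d * y ^ (k - 1)"
  define n where "n = real (vdeg F v)"
  define S where "S = (\<Sum>e\<in>E. \<Sum>u\<in>e. g u)"
  have finE: "finite E" and EF: "E \<subseteq> F" using finF by (auto simp: E_def)
  have nE: "n = card E" by (simp add: n_def vdeg_def E_def)
  have n: "0 \<le> n" "n \<le> D" using deg_le[OF v] by (auto simp: n_def)
  have "d1 \<le> d * 1" unfolding d1_def using d y by (intro mult_left_mono power_le_one) auto
  then have d1: "0 \<le> d1" "d1 \<le> D" using d y by (auto simp: d1_def)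
  have KD: "K / D \<ge> 0" using K_nonneg D by simp
  have S_nn: "S \<ge> 0" unfolding S_def by (intro sum_nonneg g_nonneg)
  \<comment> \<open>If \<open>v\<close> is covered, every edge at \<open>v\<close> is dead as well,
    so the indicator need only be kept in the constant term. No conditional expectation is
    required.\<close>
  have expand: "of_bool (v \<notin> \<Union>(set xs)) * (real (vdeg {e\<in>F. e \<inter> \<Union>(set xs) = {}} v) - d1)\<^sup>2
      = (\<Sum>e\<in>E. \<Sum>f\<in>E. alive (e \<union> f) xs) - 2 * d1 * (\<Sum>e\<in>E. alive e xs) + d1\<^sup>2 * alive {v} xs" for xs
  proof (cases "v \<in> \<Union>(set xs)")
    case True
    then have "alive e xs = 0" if "e \<in> E" for e using that by (auto simp: alive_def E_def)
    moreover have "alive {v} xs = 0" using True by (auto simp: alive_def)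
    ultimately show ?thesis using True by (simp add: alive_Un)
  next
    case False
    have "real (vdeg {e\<in>F. e \<inter> \<Union>(set xs) = {}} v) = card {e\<in>E. e \<inter> \<Union>(set xs) = {}}"
      unfolding vdeg_def E_def by (intro arg_cong[of _ _ "\<lambda>x. real (card x)"]) auto
    also have "\<dots> = (\<Sum>e\<in>E. alive e xs)"
      unfolding alive_def using finE by (simp add: sum.If_cases of_bool_def Int_def)
    finally have c: "real (vdeg {e\<in>F. e \<inter> \<Union>(set xs) = {}} v) = (\<Sum>e\<in>E. alive e xs)" .
    have "alive {v} xs = 1" using False by (auto simp: alive_def)
    then show ?thesis unfolding c using False
      by (simp add: alive_Un power2_diff sum_product[symmetric]) (simp add: power2_eq_square)
  qed
  have card_e: "card e = k" "e \<subseteq> W" "finite e" "v \<in> e" if "e \<in> E" for e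
    using that FW fin_edge by (auto simp: E_def)
  have single: "y ^ k - \<theta> - K / D * (\<Sum>u\<in>e. g u) \<le> q e" if "e \<in> E" for e
    using q_approx[of e] card_e[OF that] by (simp add: abs_le_iff)
  \<comment> \<open>Two edges meeting only in \<open>v\<close> span 2k - 1 vertices. Other pairs get
    the trivial bound 1; the codegree condition allows at most k C of them for each
    \<open>e\<close>.\<close>
  have pair: "q (e \<union> f) \<le> y ^ (2 * k - 1) + \<theta> + K / D * ((\<Sum>u\<in>e. g u) + (\<Sum>u\<in>f. g u))
       + of_bool (e \<inter> f \<noteq> {v})" if e: "e \<in> E" and f: "f \<in> E" for e f
  proof (cases "e \<inter> f = {v}")
    case True
    have "card (e \<union> f) = 2 * k - 1"
      using card_Un_Int[of e f] card_e[OF e] card_e[OF f] True by simp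
    then have "q (e \<union> f) \<le> y ^ (2 * k - 1) + \<theta> + K / D * (\<Sum>u\<in>e\<union>f. g u)"
      using q_approx[of "e \<union> f"] card_e(2)[OF e] card_e(2)[OF f] by (simp add: abs_le_iff)
    moreover have "(\<Sum>u\<in>e\<union>f. g u) \<le> (\<Sum>u\<in>e. g u) + (\<Sum>u\<in>f. g u)"
      using card_e[OF e] card_e[OF f] sum.union_inter[of e f g] sum_nonneg[of "e \<inter> f" g] g_nonneg by simp
    then have "K / D * (\<Sum>u\<in>e\<union>f. g u) \<le> K / D * ((\<Sum>u\<in>e. g u) + (\<Sum>u\<in>f. g u))"
      using KD by (rule mult_left_mono)
    ultimately show ?thesis using True by simp
  next
    case False
    have "0 \<le> y ^ (2 * k - 1)" using y by simp
    moreover have "0 \<le> K / D * ((\<Sum>u\<in>e. g u) + (\<Sum>u\<in>f. g u))"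
      by (intro mult_nonneg_nonneg[OF KD] add_nonneg_nonneg sum_nonneg g_nonneg)
    ultimately show ?thesis using False q_bounds[of "e \<union> f"] \<theta>_nonneg by simp
  qed
  have bad: "(\<Sum>f\<in>E. of_bool (e \<inter> f \<noteq> {v})) \<le> k * C" if e: "e \<in> E" for e
  proof -
    have "(\<Sum>f\<in>E. of_bool (e \<inter> f \<noteq> {v})) = real (card {f\<in>E. e \<inter> f \<noteq> {v}})"
      using finE by (simp add: sum.If_cases of_bool_def Int_def)
    also have "card {f\<in>E. e \<inter> f \<noteq> {v}} \<le> card (\<Union>u\<in>e-{v}. {f\<in>F. v \<in> f \<and> u \<in> f})"
      using card_e[OF e] finF by (intro card_mono finite_UN_I) (auto simp: E_def)
    also have "\<dots> \<le> (\<Sum>u\<in>e-{v}. codeg F v u)"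
      unfolding codeg_def using card_e[OF e] by (intro card_UN_le) simp
    also have "real \<dots> = (\<Sum>u\<in>e-{v}. real (codeg F v u))" by simp
    also have "\<dots> \<le> (\<Sum>u\<in>e-{v}. C)"
      using card_e[OF e] v by (intro sum_mono codeg_le) auto
    also have "\<dots> = card (e - {v}) * C" by simp
    also have "\<dots> \<le> k * C" using card_e[OF e] C by (intro mult_right_mono) auto
    finally show ?thesis by simp
  qed
  have vs: "q {v} \<le> y + \<theta> + K / D * g v"
    using q_approx[of "{v}"] v k_pos by (simp add: abs_le_iff)
  have A: "(\<Sum>e\<in>E. \<Sum>f\<in>E. q (e \<union> f)) \<le>
      n\<^sup>2 * y ^ (2 * k - 1) + n\<^sup>2 * \<theta> + 2 * n * (K / D * S) + n * (k * C)"
  proof -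
    have "(\<Sum>e\<in>E. \<Sum>f\<in>E. q (e \<union> f)) \<le> (\<Sum>e\<in>E. \<Sum>f\<in>E. y ^ (2 * k - 1) + \<theta> +
        K / D * ((\<Sum>u\<in>e. g u) + (\<Sum>u\<in>f. g u)) + of_bool (e \<inter> f \<noteq> {v}))"
      by (intro sum_mono pair)
    also have "\<dots> = n\<^sup>2 * y ^ (2 * k - 1) + n\<^sup>2 * \<theta> + 2 * n * (K / D * S) +
        (\<Sum>e\<in>E. \<Sum>f\<in>E. of_bool (e \<inter> f \<noteq> {v}))"
      by (simp only: sum.distrib sum_distrib_left[symmetric] S_def[symmetric] sum_constant nE[symmetric])
         (simp add: algebra_simps power2_eq_square)
    also have "(\<Sum>e\<in>E. \<Sum>f\<in>E. of_bool (e \<inter> f \<noteq> {v})) \<le> (\<Sum>e\<in>E. k * C)"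
      by (intro sum_mono bad)
    also have "\<dots> = n * (k * C)" by (simp add: nE)
    finally show ?thesis by simp
  qed
  have B: "n * y ^ k - n * \<theta> - K / D * S \<le> (\<Sum>e\<in>E. q e)"
  proof -
    have "n * y ^ k - n * \<theta> - K / D * S = (\<Sum>e\<in>E. y ^ k - \<theta> - K / D * (\<Sum>u\<in>e. g u))"
      by (simp only: sum_subtractf sum_distrib_left[symmetric] S_def sum_constant nE[symmetric])
    also have "\<dots> \<le> (\<Sum>e\<in>E. q e)" by (intro sum_mono single)
    finally show ?thesis .
  qed
  have "mean L (\<lambda>xs. of_bool (v \<notin> \<Union>(set xs)) * (real (vdeg {e\<in>F. e \<inter> \<Union>(set xs) = {}} v) - d1)\<^sup>2)
      = (\<Sum>e\<in>E. \<Sum>f\<in>E. q (e \<union> f)) - 2 * d1 * (\<Sum>e\<in>E. q e) + d1\<^sup>2 * q {v}"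
    unfolding expand mean_sum mean_add mean_diff mean_cmult mean_alive ..
  also have "\<dots> \<le> (n\<^sup>2 * y ^ (2 * k - 1) + n\<^sup>2 * \<theta> + 2 * n * (K / D * S) + n * (k * C))
      - 2 * d1 * (n * y ^ k - n * \<theta> - K / D * S) + d1\<^sup>2 * (y + \<theta> + K / D * g v)"
    using A mult_left_mono[OF B, of "2 * d1"] mult_left_mono[OF vs, of "d1\<^sup>2"] d1 by simp
  also have "\<dots> = (n\<^sup>2 * y ^ (2 * k - 1) - 2 * d1 * n * y ^ k + d1\<^sup>2 * y)
      + (n + d1)\<^sup>2 * \<theta> + 2 * (n + d1) * (K / D * S) + n * (k * C) + d1\<^sup>2 * (K / D * g v)"
    by (simp add: algebra_simps power2_eq_square)
  \<comment> \<open>The exponents 2k - 1, k and 1, with the power k - 1 inside \<open>d1\<close>,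
    combine to a perfect square.\<close>
  also have "n\<^sup>2 * y ^ (2 * k - 1) - 2 * d1 * n * y ^ k + d1\<^sup>2 * y = y * (y ^ (k - 1))\<^sup>2 * (n - d)\<^sup>2"
  proof -
    obtain l where l: "k = Suc l" using k_pos by (cases k) auto
    have "y ^ (2 * k - 1) = y * (y ^ l)\<^sup>2" by (simp add: l power_mult[symmetric] mult.commute)
    then show ?thesis by (simp add: d1_def l algebra_simps power2_eq_square)
  qed
  also have "\<dots> \<le> 1 * (n - d)\<^sup>2"
    using y by (intro mult_right_mono mult_le_one power_le_one) auto
  also have "1 * (n - d)\<^sup>2 = g v * g v" by (simp add: g_def n_def power2_eq_square)
  also have "\<dots> \<le> D * g v" using g_le[OF v] g_nonneg by (intro mult_right_mono) auto
  also have "(n + d1)\<^sup>2 * \<theta> \<le> (2 * D)\<^sup>2 * \<theta>"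
    using n d1 \<theta>_nonneg by (intro mult_right_mono power_mono) auto
  also have "2 * (n + d1) * (K / D * S) \<le> 2 * (2 * D) * (K / D * S)"
    using n d1 by (intro mult_right_mono mult_left_mono mult_nonneg_nonneg KD S_nn) auto
  also have "n * (k * C) \<le> D * (k * C)" using n C by (intro mult_right_mono) auto
  also have "d1\<^sup>2 * (K / D * g v) \<le> D\<^sup>2 * (K / D * g v)"
    using d1 by (intro mult_right_mono power_mono mult_nonneg_nonneg KD g_nonneg) auto
  also have "D * g v + (2 * D)\<^sup>2 * \<theta> + 2 * (2 * D) * (K / D * S) + D * (k * C) + D\<^sup>2 * (K / D * g v)
      = 4 * D\<^sup>2 * \<theta> + D * k * C + (K + 1) * D * g v + 4 * K * S"
    using D by (simp add: algebra_simps power2_eq_square)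
  finally show ?thesis unfolding S_def E_def d1_def by simp
qed

text \<open>In the double count each deviation \<open>g u\<close> occurs k times for every edge
  through \<open>u\<close>, so at most k D times. The pointwise degree bound thus keeps the
  propagated error a multiple of \<open>G\<close>.\<close>

lemma mean_degrees:
  "mean L (\<lambda>xs. \<Sum>v\<in>W - \<Union>(set xs).
      (real (vdeg {e\<in>F. e \<inter> \<Union>(set xs) = {}} v) - d * y ^ (k - 1))\<^sup>2)
    \<le> (4 * D\<^sup>2 * \<theta> + D * k * C) * card W + (K + 1 + 4 * K * k) * D * G"
proof -
  have split: "(\<Sum>v\<in>W - X. h v) = (\<Sum>v\<in>W. of_bool (v \<notin> X) * h v)" for h :: "'a \<Rightarrow> real" and X
    using finW by (intro sum.mono_neutral_cong_left) auto
  have "(\<Sum>v\<in>W. \<Sum>e\<in>{e\<in>F. v \<in> e}. \<Sum>u\<in>e. g u) = (\<Sum>v\<in>W. \<Sum>e\<in>F. of_bool (v \<in> e) * (\<Sum>u\<in>e. g u))"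
    using finF by (intro sum.cong sum.mono_neutral_cong_left) auto
  also have "\<dots> = (\<Sum>e\<in>F. \<Sum>v\<in>W. of_bool (v \<in> e) * (\<Sum>u\<in>e. g u))" by (rule sum.swap)
  also have "\<dots> = (\<Sum>e\<in>F. k * (\<Sum>u\<in>e. g u))"
  proof (intro sum.cong refl)
    fix e assume e: "e \<in> F"
    then have "W \<inter> e = e" "card e = k" using FW by auto
    then show "(\<Sum>v\<in>W. of_bool (v \<in> e) * (\<Sum>u\<in>e. g u)) = k * (\<Sum>u\<in>e. g u)"
      using finW by (simp add: sum_distrib_right[symmetric] of_bool_def sum.If_cases Int_def)
  qed
  also have "\<dots> = k * (\<Sum>e\<in>F. \<Sum>u\<in>W. of_bool (u \<in> e) * g u)"
    unfolding sum_distrib_left[symmetric] using FW finW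
    by (intro arg_cong[of _ _ "\<lambda>x. real k * x"] sum.cong refl sum.mono_neutral_cong_left) auto
  also have "(\<Sum>e\<in>F. \<Sum>u\<in>W. of_bool (u \<in> e) * g u) = (\<Sum>u\<in>W. \<Sum>e\<in>F. of_bool (u \<in> e) * g u)"
    by (rule sum.swap)
  also have "\<dots> = (\<Sum>u\<in>W. vdeg F u * g u)"
    unfolding vdeg_def using finF
    by (simp add: sum_distrib_right[symmetric] of_bool_def sum.If_cases Int_def)
  also have "\<dots> \<le> (\<Sum>u\<in>W. D * g u)"
    by (intro sum_mono mult_right_mono deg_le g_nonneg)
  also have "\<dots> = D * G" by (simp add: G_def sum_distrib_left)
  finally have S: "(\<Sum>v\<in>W. \<Sum>e\<in>{e\<in>F. v \<in> e}. \<Sum>u\<in>e. g u) \<le> k * (D * G)"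
    by (simp add: mult_left_mono)
  have "mean L (\<lambda>xs. \<Sum>v\<in>W - \<Union>(set xs).
      (real (vdeg {e\<in>F. e \<inter> \<Union>(set xs) = {}} v) - d * y ^ (k - 1))\<^sup>2)
    \<le> (\<Sum>v\<in>W. 4 * D\<^sup>2 * \<theta> + D * k * C + (K + 1) * D * g v
        + 4 * K * (\<Sum>e\<in>{e\<in>F. v \<in> e}. \<Sum>u\<in>e. g u))"
    unfolding split mean_sum by (intro sum_mono mean_degree_at)
  also have "\<dots> = (4 * D\<^sup>2 * \<theta> + D * k * C) * card W + (K + 1) * D * G
        + 4 * K * (\<Sum>v\<in>W. \<Sum>e\<in>{e\<in>F. v \<in> e}. \<Sum>u\<in>e. g u)"
    unfolding sum.distrib sum_distrib_left[symmetric] G_def[symmetric] by (simp add: algebra_simps)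
  also have "\<dots> \<le> (4 * D\<^sup>2 * \<theta> + D * k * C) * card W + (K + 1) * D * G + 4 * K * (k * (D * G))"
    using S K_nonneg by (intro add_left_mono mult_left_mono) auto
  finally show ?thesis by (simp add: algebra_simps)
qed

text \<open>Adding the two normalized second moments lets a single outcome be good for both. The
  normalization uses the original vertex count \<open>N\<close> instead of the current one, so that
  rounds can be compared.\<close>

lemma round_exists:
  assumes N: "real (card W) \<le> N" "N > 0"
  shows "\<exists>xs. set xs \<subseteq> F \<and> length xs = m \<and>
    (real (card (W - \<Union>(set xs))) - y * card W)\<^sup>2 / N\<^sup>2 +
    (\<Sum>v\<in>W - \<Union>(set xs). (real (vdeg {e\<in>F. e \<inter> \<Union>(set xs) = {}} v) - d * y ^ (k - 1))\<^sup>2) / (N * D\<^sup>2)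
    \<le> 7 * \<theta> + 1 / N + k * (C / D) + (5 * K + 1 + 4 * K * k) * (G / (N * D))"
proof -
  have N0: "N > 0" using N by simp
  have G: "G \<ge> 0" unfolding G_def by (intro sum_nonneg g_nonneg)
  define f1 where "f1 = (\<lambda>xs::'a set list. (real (card (W - \<Union>(set xs))) - y * card W)\<^sup>2)"
  define f2 where "f2 = (\<lambda>xs::'a set list. \<Sum>v\<in>W - \<Union>(set xs).
     (real (vdeg {e\<in>F. e \<inter> \<Union>(set xs) = {}} v) - d * y ^ (k - 1))\<^sup>2)"
  obtain xs where xs: "xs \<in> L" and
    le: "1 / N\<^sup>2 * f1 xs + 1 / (N * D\<^sup>2) * f2 xs \<le> mean L (\<lambda>xs. 1 / N\<^sup>2 * f1 xs + 1 / (N * D\<^sup>2) * f2 xs)"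
    using exists_le_mean[OF finL L_ne, of "\<lambda>xs. 1 / N\<^sup>2 * f1 xs + 1 / (N * D\<^sup>2) * f2 xs"]
    by (rule bexE)
  note le
  also have "mean L (\<lambda>xs. 1 / N\<^sup>2 * f1 xs + 1 / (N * D\<^sup>2) * f2 xs) =
     1 / N\<^sup>2 * mean L f1 + 1 / (N * D\<^sup>2) * mean L f2" by (simp only: mean_add mean_cmult)
  also have "\<dots> \<le> 1 / N\<^sup>2 * (3 * \<theta> * N\<^sup>2 + 4 * K / D * N * G + N)
      + 1 / (N * D\<^sup>2) * ((4 * D\<^sup>2 * \<theta> + D * k * C) * N + (K + 1 + 4 * K * k) * D * G)"
  proof (intro add_mono mult_left_mono)
    have "mean L f1 \<le> 3 * \<theta> * (card W)\<^sup>2 + 4 * K / D * card W * G + card W"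
      unfolding f1_def by (rule mean_survivors)
    also have "\<dots> \<le> 3 * \<theta> * N\<^sup>2 + 4 * K / D * N * G + N"
    proof -
      have "3 * \<theta> * (card W)\<^sup>2 \<le> 3 * \<theta> * N\<^sup>2"
        using N \<theta>_nonneg by (simp add: power_mono mult_left_mono)
      moreover have "4 * K / D * card W * G \<le> 4 * K / D * N * G"
        using N K_nonneg D G by (intro mult_right_mono mult_left_mono) auto
      ultimately show ?thesis using N by linarith
    qed
    finally show "mean L f1 \<le> 3 * \<theta> * N\<^sup>2 + 4 * K / D * N * G + N" .
    have "mean L f2 \<le> (4 * D\<^sup>2 * \<theta> + D * k * C) * card W + (K + 1 + 4 * K * k) * D * G"
      unfolding f2_def by (rule mean_degrees)
    also have "\<dots> \<le> (4 * D\<^sup>2 * \<theta> + D * k * C) * N + (K + 1 + 4 * K * k) * D * G"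
      using N \<theta>_nonneg D C by (intro add_right_mono mult_left_mono) auto
    finally show "mean L f2 \<le> (4 * D\<^sup>2 * \<theta> + D * k * C) * N + (K + 1 + 4 * K * k) * D * G" .
  qed (use N0 D in auto)
  \<comment> \<open>Here 7 = 3 + 4 collects the \<open>\<theta>\<close> terms of the two moments,
    and 5K = 4K + K their \<open>G\<close> terms.\<close>
  also have "\<dots> = 7 * \<theta> + 1 / N + k * (C / D) + (5 * K + 1 + 4 * K * k) * (G / (N * D))"
    using N0 D by (simp add: field_simps power2_eq_square)
  finally show ?thesis using xs unfolding L_def f1_def f2_def by auto
qed

end

section \<open>Almost perfect matchings\<close>

text \<open>Each factor 1 - a differs from exp(-a) by at most a^2, and m such errors sum to (m a) a,
  which tends to c * 0.\<close>

lemma tendsto_power_exp: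
  fixes a :: "nat \<Rightarrow> real" and m :: "nat \<Rightarrow> nat"
  assumes a0: "\<And>n. 0 \<le> a n" and a: "a \<longlonglongrightarrow> 0" and ma: "(\<lambda>n. m n * a n) \<longlonglongrightarrow> c"
  shows "(\<lambda>n. (1 - a n) ^ m n) \<longlonglongrightarrow> exp (- c)"
proof -
  have ev: "\<forall>\<^sub>F n in sequentially. a n < 1"
    using a by (rule order_tendstoD) simp
  have "(\<lambda>n. (1 - a n) ^ m n - exp (- (m n * a n))) \<longlonglongrightarrow> 0"
  proof (rule Lim_null_comparison)
    show "(\<lambda>n. (m n * a n) * a n) \<longlonglongrightarrow> 0"
      using tendsto_mult[OF ma a] by simp
    show "\<forall>\<^sub>F n in sequentially. norm ((1 - a n) ^ m n - exp (- (m n * a n))) \<le> (m n * a n) * a n"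
      using ev
    proof eventually_elim
      case (elim n)
      have "1 - a n \<le> exp (- a n)" using exp_ge_add_one_self[of "- a n"] by simp
      moreover have "exp (- a n) \<le> 1 - a n + a n * a n"
      proof -
        have "1 \<le> (1 - a n + a n * a n) * (1 + a n)"
          using a0[of n] by (simp add: algebra_simps)
        also have "\<dots> \<le> (1 - a n + a n * a n) * exp (a n)"
          using elim a0[of n] exp_ge_add_one_self[of "a n"] by (intro mult_left_mono) auto
        finally show ?thesis by (simp add: exp_minus field_simps)
      qed
      ultimately have b: "norm ((1 - a n) - exp (- a n)) \<le> a n * a n" by simp
      have "norm ((1 - a n) ^ m n - exp (- a n) ^ m n) \<le> m n * norm ((1 - a n) - exp (- a n))"
        using elim a0[of n] by (intro norm_power_diff) auto
      also have "\<dots> \<le> m n * (a n * a n)" using b by (intro mult_left_mono) auto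
      finally show ?case by (simp add: exp_of_nat_mult[symmetric] algebra_simps)
    qed
  qed
  moreover have "(\<lambda>n. exp (- (m n * a n))) \<longlonglongrightarrow> exp (- c)"
    by (intro tendsto_intros ma)
  ultimately have "(\<lambda>n. ((1 - a n) ^ m n - exp (- (m n * a n))) + exp (- (m n * a n))) \<longlonglongrightarrow> 0 + exp (- c)"
    by (rule tendsto_add)
  then show ?thesis by simp
qed

lemma tendsto_zero_of_power2:
  fixes f :: "nat \<Rightarrow> real"
  assumes "(\<lambda>n. (f n)\<^sup>2) \<longlonglongrightarrow> 0"
  shows "f \<longlonglongrightarrow> 0"
proof -
  have "(\<lambda>n. sqrt ((f n)\<^sup>2)) \<longlonglongrightarrow> sqrt 0" by (intro tendsto_intros assms)
  then show ?thesis by (simp add: tendsto_rabs_zero_iff)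
qed

definition inner_edges :: "'a set set \<Rightarrow> 'a set \<Rightarrow> 'a set set" where
  "inner_edges E W = {e\<in>E. e \<subseteq> W}"

lemma sum_vdeg:
  assumes "finite W" "\<And>e. e \<in> F \<Longrightarrow> e \<subseteq> W \<and> card e = k"
  shows "(\<Sum>v\<in>W. vdeg F v) = k * card F"
proof -
  have finF: "finite F" by (rule finite_subset[of _ "Pow W"]) (use assms in auto)
  have "(\<Sum>v\<in>W. vdeg F v) = (\<Sum>v\<in>W. \<Sum>e\<in>F. if v \<in> e then 1 else 0)"
    unfolding vdeg_def using finF by (simp add: sum.If_cases Int_def)
  also have "\<dots> = (\<Sum>e\<in>F. \<Sum>v\<in>W. if v \<in> e then 1 else 0)" by (rule sum.swap)
  also have "\<dots> = (\<Sum>e\<in>F. k)"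
  proof (intro sum.cong refl)
    fix e assume "e \<in> F"
    then have "W \<inter> e = e" "card e = k" using assms by auto
    then show "(\<Sum>v\<in>W. if v \<in> e then 1 else 0) = k"
      using assms by (simp add: sum.If_cases Int_def)
  qed
  finally show ?thesis by simp
qed

section \<open>Iterating the round along a sequence of regular hypergraphs\<close>

locale regular_hypergraphs =
  fixes V :: "nat \<Rightarrow> 'a set" and E :: "nat \<Rightarrow> 'a set set" and k :: nat and D C :: "nat \<Rightarrow> real"
  assumes finV: "\<And>n. finite (V n)" and EV: "\<And>e n. e \<in> E n \<Longrightarrow> e \<subseteq> V n \<and> card e = k" and k_pos: "k > 0"
    and regular: "\<And>v n. v \<in> V n \<Longrightarrow> real (vdeg (E n) v) = D n"
    and codeg_le: "\<And>u v n. u \<in> V n \<Longrightarrow> v \<in> V n \<Longrightarrow> u \<noteq> v \<Longrightarrow> real (codeg (E n) u v) \<le> C n"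
    and C_nonneg: "\<And>n. C n \<ge> 0"
    and D_pos: "\<forall>\<^sub>F n in sequentially. D n > 0"
    and C_small: "(\<lambda>n. C n / D n) \<longlonglongrightarrow> 0"
    and V_large: "filterlim (\<lambda>n. real (card (V n))) at_top sequentially"
begin

abbreviation "N n \<equiv> real (card (V n))"

text \<open>\<open>W\<close> behaves like a random set of density \<open>x\<close>: an edge at a vertex of \<open>W\<close> has its other
  \<open>k - 1\<close> vertices in \<open>W\<close> with probability \<open>x ^ (k - 1)\<close>.\<close>

definition quasi_regular :: "real \<Rightarrow> (nat \<Rightarrow> 'a set) \<Rightarrow> bool" where
  "quasi_regular x W \<longleftrightarrow> (\<forall>n. W n \<subseteq> V n) \<and> (\<lambda>n. card (W n) / N n) \<longlonglongrightarrow> x \<and>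
    (\<lambda>n. (\<Sum>v\<in>W n. \<bar>real (vdeg (inner_edges (E n) (W n)) v) - x ^ (k - 1) * D n\<bar>) / (N n * D n)) \<longlonglongrightarrow> 0"

lemma edge_subset: "e \<in> E n \<Longrightarrow> e \<subseteq> V n" and edge_card: "e \<in> E n \<Longrightarrow> card e = k"
  using EV[of e n] by simp_all

lemma finE: "finite (E n)"
  by (rule finite_subset[of _ "Pow (V n)"]) (use edge_subset finV in auto)

lemma N_pos: "\<forall>\<^sub>F n in sequentially. N n > 0"
  using V_large unfolding filterlim_at_top_dense by blast

lemma inverse_N: "(\<lambda>n. 1 / N n) \<longlonglongrightarrow> 0"
  using tendsto_inverse_0_at_top[OF V_large] by (simp add: inverse_eq_divide)

lemma vdeg_le: "F \<subseteq> E n \<Longrightarrow> v \<in> V n \<Longrightarrow> real (vdeg F v) \<le> D n"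
proof (rule order.trans[OF _ eq_refl[OF regular]])
  assume "F \<subseteq> E n"
  then show "real (vdeg F v) \<le> real (vdeg (E n) v)"
    unfolding vdeg_def using finE by (auto intro!: card_mono)
qed auto

lemma codeg_le': "F \<subseteq> E n \<Longrightarrow> u \<in> V n \<Longrightarrow> v \<in> V n \<Longrightarrow> u \<noteq> v \<Longrightarrow> real (codeg F u v) \<le> C n"
proof (rule order.trans[OF _ codeg_le])
  assume "F \<subseteq> E n"
  then show "real (codeg F u v) \<le> real (codeg (E n) u v)"
    unfolding codeg_def using finE by (auto intro!: card_mono)
qed auto

text \<open>An edge at a surviving vertex keeps its other k - 1 vertices with probability about
  y^(k-1), where y = exp(-\<epsilon>). The degrees x^(k-1) D thus become (x y)^(k-1) D, the value
  required at density x y.\<close>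

lemma quasi_regular_step:
  assumes qr: "quasi_regular x W" and x: "0 < x" "x \<le> 1" and \<epsilon>: "\<epsilon> > 0"
  shows "\<exists>xs. (\<forall>n. set (xs n) \<subseteq> inner_edges (E n) (W n)) \<and>
    (\<lambda>n. length (xs n) / N n) \<longlonglongrightarrow> \<epsilon> * x / k \<and>
    quasi_regular (x * exp (- \<epsilon>)) (\<lambda>n. W n - \<Union>(set (xs n)))"
proof -
  define y where "y = exp (- \<epsilon>)"
  have y: "0 \<le> y" "y \<le> 1" using \<epsilon> by (auto simp: y_def)
  define F where "F n = inner_edges (E n) (W n)" for n
  define M where "M n = real (card (F n))" for n
  \<comment> \<open>As \<open>M\<close> is about x^k N D / k and d = x^(k-1) D, this choice gives m
    d / M -> \<epsilon>. A typical vertex then lies in \<epsilon> drawn edges on average and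
    survives with probability about exp(-\<epsilon>).\<close>
  define m where "m n = nat \<lfloor>\<epsilon> * card (W n) / k\<rfloor>" for n
  define d where "d n = x ^ (k - 1) * D n" for n
  define G where "G n = (\<Sum>v\<in>W n. \<bar>real (vdeg (F n) v) - d n\<bar>)" for n
  have WV: "W n \<subseteq> V n" for n using qr by (simp add: quasi_regular_def)
  then have finW: "finite (W n)" for n using finV finite_subset by blast
  have W_lim: "(\<lambda>n. card (W n) / N n) \<longlonglongrightarrow> x" using qr by (simp add: quasi_regular_def)
  have G_lim: "(\<lambda>n. G n / (N n * D n)) \<longlonglongrightarrow> 0"
    using qr by (simp add: quasi_regular_def G_def F_def d_def)
  have FE: "F n \<subseteq> E n" for n by (auto simp: F_def inner_edges_def)
  have FW: "e \<subseteq> W n \<and> card e = k" if "e \<in> F n" for e n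
    using that EV by (auto simp: F_def inner_edges_def)
  have pos: "\<forall>\<^sub>F n in sequentially. N n > 0 \<and> D n > 0"
    using N_pos D_pos by eventually_elim simp

  have pow_k: "x ^ k = x ^ (k - 1) * x" using k_pos by (cases k) auto
  have M_lim: "(\<lambda>n. M n / (N n * D n)) \<longlonglongrightarrow> x ^ k / k"
  proof -
    \<comment> \<open>By the handshake count k M is the degree sum over \<open>W\<close>, which
      differs from |W| d by at most \<open>G\<close>.\<close>
    have "(\<lambda>n. k * M n / (N n * D n) - x ^ (k - 1) * (card (W n) / N n)) \<longlonglongrightarrow> 0"
    proof (rule Lim_null_comparison[OF _ G_lim])
      show "\<forall>\<^sub>F n in sequentially. norm (k * M n / (N n * D n) - x ^ (k - 1) * (card (W n) / N n)) \<le> G n / (N n * D n)"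
        using pos
      proof eventually_elim
        case (elim n)
        have "k * M n = (\<Sum>v\<in>W n. real (vdeg (F n) v))"
          unfolding M_def using arg_cong[OF sum_vdeg[OF finW[of n] FW, of "F n"], of real] by simp
        then have "k * M n - card (W n) * d n = (\<Sum>v\<in>W n. real (vdeg (F n) v) - d n)"
          by (simp add: sum_subtractf)
        then have "\<bar>k * M n - card (W n) * d n\<bar> \<le> G n"
          unfolding G_def by (simp add: sum_abs)
        then have "\<bar>k * M n - card (W n) * d n\<bar> / (N n * D n) \<le> G n / (N n * D n)"
          using elim by (intro divide_right_mono) auto
        moreover have "k * M n / (N n * D n) - x ^ (k - 1) * (card (W n) / N n) =
           (k * M n - card (W n) * d n) / (N n * D n)"
          using elim by (simp add: d_def field_simps)
        ultimately show ?case using elim by simp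
      qed
    qed
    from tendsto_add[OF this tendsto_mult_left[OF W_lim, of "x ^ (k - 1)"]]
    have "(\<lambda>n. k * M n / (N n * D n)) \<longlonglongrightarrow> x ^ (k - 1) * x" by simp
    also note pow_k[symmetric]
    finally have "(\<lambda>n. (k * M n / (N n * D n)) / k) \<longlonglongrightarrow> x ^ k / k"
      by (intro tendsto_divide tendsto_const) (use k_pos in auto)
    then show ?thesis using k_pos by simp
  qed
  have xk: "x ^ k / k > 0" using x k_pos by simp
  then have xk0: "x ^ k / k \<noteq> 0" by linarith
  have M_pos: "\<forall>\<^sub>F n in sequentially. M n / (N n * D n) > 0"
    using M_lim xk by (rule order_tendstoD)

  have m_lim: "(\<lambda>n. m n / N n) \<longlonglongrightarrow> \<epsilon> * x / k"
  proof -
    have "(\<lambda>n. m n / N n - (\<epsilon> / k) * (card (W n) / N n)) \<longlonglongrightarrow> 0"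
    proof (rule Lim_null_comparison[OF _ inverse_N])
      show "\<forall>\<^sub>F n in sequentially. norm (m n / N n - (\<epsilon> / k) * (card (W n) / N n)) \<le> 1 / N n"
        using pos
      proof eventually_elim
        case (elim n)
        have "0 \<le> \<epsilon> * card (W n) / k" using \<epsilon> by simp
        then have "real (m n) = of_int \<lfloor>\<epsilon> * card (W n) / k\<rfloor>" by (simp add: m_def)
        then have "\<bar>m n - \<epsilon> * card (W n) / k\<bar> \<le> 1" by linarith
        then have "\<bar>m n - \<epsilon> * card (W n) / k\<bar> / N n \<le> 1 / N n" by (intro divide_right_mono) auto
        moreover have "m n / N n - (\<epsilon> / k) * (card (W n) / N n) = (m n - \<epsilon> * card (W n) / k) / N n"
          by (simp add: diff_divide_distrib)
        ultimately show ?case by simp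
      qed
    qed
    from tendsto_add[OF this tendsto_mult_left[OF W_lim, of "\<epsilon> / k"]] show ?thesis by simp
  qed
  define K where "K = \<epsilon> / x ^ (k - 1) + 1"
  have mDM: "(\<lambda>n. m n * D n / M n) \<longlonglongrightarrow> \<epsilon> / x ^ (k - 1)"
  proof -
    have "(\<lambda>n. (m n / N n) / (M n / (N n * D n))) \<longlonglongrightarrow> (\<epsilon> * x / k) / (x ^ k / k)"
      by (rule tendsto_divide[OF m_lim M_lim xk0])
    also have "(\<epsilon> * x / k) / (x ^ k / k) = \<epsilon> / x ^ (k - 1)"
    proof -
      have "x / k \<noteq> 0" using x k_pos by simp
      from nonzero_mult_divide_mult_cancel_right[OF this] show ?thesis
        by (simp only: pow_k times_divide_eq_right)
    qed
    finally show ?thesis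
      by (rule Lim_transform_eventually) (use pos in \<open>eventually_elim, simp\<close>)
  qed
  have K_ev: "\<forall>\<^sub>F n in sequentially. m n * D n / M n < K"
    using mDM by (rule order_tendstoD) (simp add: K_def)
  have d_lim: "(\<lambda>n. d n / M n) \<longlonglongrightarrow> 0"
  proof -
    have "(\<lambda>n. x ^ (k - 1) * (1 / N n) / (M n / (N n * D n))) \<longlonglongrightarrow> x ^ (k - 1) * 0 / (x ^ k / k)"
      by (rule tendsto_divide[OF tendsto_mult_left[OF inverse_N] M_lim xk0])
    then have "(\<lambda>n. x ^ (k - 1) * (1 / N n) / (M n / (N n * D n))) \<longlonglongrightarrow> 0" by simp
    then show ?thesis
      by (rule Lim_transform_eventually) (use pos in \<open>eventually_elim, simp add: d_def\<close>)
  qed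
  have small_ev: "\<forall>\<^sub>F n in sequentially. 2 * k * (d n / M n) < 1"
    using tendsto_mult_left[OF d_lim, of "2 * k"] by (rule order_tendstoD) simp
  \<comment> \<open>The sum dominates the errors for all j at once. The absolute value is taken
    since \<open>D n\<close> is positive only eventually, while \<open>tendsto_power_exp\<close>
    wants nonnegative terms for every n.\<close>
  define w where "w n = (\<Sum>j\<le>2 * k. \<bar>(1 - j * \<bar>d n / M n\<bar>) ^ m n - y ^ j\<bar>)" for n
  have w_lim: "w \<longlonglongrightarrow> 0"
  proof -
    have "(\<lambda>n. (1 - j * \<bar>d n / M n\<bar>) ^ m n) \<longlonglongrightarrow> exp (- (j * \<bar>\<epsilon>\<bar>))" for j :: nat
    proof (rule tendsto_power_exp)
      show "(\<lambda>n. j * \<bar>d n / M n\<bar>) \<longlonglongrightarrow> 0"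
        using tendsto_mult_left[OF tendsto_rabs[OF d_lim], of j] by simp
      have "(\<lambda>n. j * \<bar>x ^ (k - 1) * (m n * D n / M n)\<bar>) \<longlonglongrightarrow> j * \<bar>x ^ (k - 1) * (\<epsilon> / x ^ (k - 1))\<bar>"
        by (intro tendsto_intros mDM)
      then show "(\<lambda>n. m n * (j * \<bar>d n / M n\<bar>)) \<longlonglongrightarrow> j * \<bar>\<epsilon>\<bar>"
        using x by (simp add: d_def abs_mult mult_ac)
    qed auto
    moreover have "exp (- (j * \<bar>\<epsilon>\<bar>)) = y ^ j" for j :: nat
      using \<epsilon> by (simp add: y_def exp_of_nat_mult[symmetric])
    ultimately have 1: "(\<lambda>n. (1 - j * \<bar>d n / M n\<bar>) ^ m n) \<longlonglongrightarrow> y ^ j" for j :: nat by simp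
    have "w \<longlonglongrightarrow> (\<Sum>j\<le>2 * k. \<bar>y ^ j - y ^ j\<bar>)"
      unfolding w_def by (intro tendsto_intros 1)
    then show ?thesis by simp
  qed

  define \<theta> where "\<theta> n = w n + 4 * k\<^sup>2 * K * C n / D n" for n
  define B where "B n = 7 * \<theta> n + 1 / N n + k * (C n / D n) + (5 * K + 1 + 4 * K * k) * (G n / (N n * D n))" for n
  have B_lim: "B \<longlonglongrightarrow> 0"
  proof -
    have "(\<lambda>n. 7 * (w n + 4 * k\<^sup>2 * K * (C n / D n)) + 1 / N n + k * (C n / D n) + (5 * K + 1 + 4 * K * k) * (G n / (N n * D n)))
      \<longlonglongrightarrow> 7 * (0 + 4 * k\<^sup>2 * K * 0) + 0 + real k * 0 + (5 * K + 1 + 4 * K * k) * 0"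
      by (intro tendsto_intros w_lim C_small inverse_N G_lim)
    then show ?thesis by (simp add: B_def[abs_def] \<theta>_def)
  qed

  define Q1 where "Q1 n xs = (real (card (W n - \<Union>(set xs))) - y * card (W n))\<^sup>2 / (N n)\<^sup>2" for n xs
  define Q2 where "Q2 n xs = (\<Sum>v\<in>W n - \<Union>(set xs).
     (real (vdeg {e\<in>F n. e \<inter> \<Union>(set xs) = {}} v) - d n * y ^ (k - 1))\<^sup>2) / (N n * (D n)\<^sup>2)" for n xs
  have ev: "\<forall>\<^sub>F n in sequentially. \<exists>xs. set xs \<subseteq> F n \<and> length xs = m n \<and> Q1 n xs + Q2 n xs \<le> B n"
    using pos M_pos K_ev small_ev
  proof eventually_elim
    case (elim n)
    have "M n \<noteq> 0" using elim by auto
    then have M: "M n > 0" by (simp add: M_def)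
    have d0: "0 \<le> d n" using elim x by (simp add: d_def)
    interpret nr: nibble_round "W n" "F n" k "m n" "d n" "D n" "C n" y K "w n"
    proof unfold_locales
      show "F n \<noteq> {}" using M by (auto simp: M_def)
      show "0 \<le> d n" by fact
      show "d n \<le> D n"
        using elim x by (simp add: d_def mult_left_le_one_le power_le_one)
      show "real (m n) * D n \<le> K * card (F n)"
        using elim M by (simp add: M_def field_simps)
      show "real (2 * k) * d n \<le> card (F n)" using elim M by (simp add: M_def field_simps)
      fix j assume j: "j \<le> 2 * k"
      have "\<bar>(1 - j * \<bar>d n / M n\<bar>) ^ m n - y ^ j\<bar> \<le> w n"
        unfolding w_def using j by (intro member_le_sum) auto
      then show "\<bar>(1 - j * d n / card (F n)) ^ m n - y ^ j\<bar> \<le> w n"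
        using d0 M by (simp add: M_def)
    next
      fix u v assume "u \<in> W n" "v \<in> W n" "u \<noteq> v"
      then show "real (codeg (F n) u v) \<le> C n"
        using codeg_le'[OF FE] WV by blast
    next
      fix v assume "v \<in> W n"
      then show "real (vdeg (F n) v) \<le> D n" using vdeg_le[OF FE] WV by blast
    next
      fix e assume "e \<in> F n"
      then show "e \<subseteq> W n \<and> card e = k" by (rule FW)
    qed (use finW[of n] k_pos C_nonneg[of n] y elim in auto)
    have "real (card (W n)) \<le> N n" using card_mono[OF finV WV] by simp
    from nr.round_exists[OF this] elim show ?case
      unfolding Q1_def Q2_def B_def \<theta>_def nr.\<theta>_def G_def nr.G_def nr.g_def by simp
  qed
  \<comment> \<open>A good outcome exists only for large n. For the other n the empty list serves,
    so that the drawn edges lie in \<open>F n\<close> without exception.\<close>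
  have "\<forall>n. \<exists>xs. set xs \<subseteq> F n \<and> ((\<exists>xs. set xs \<subseteq> F n \<and> length xs = m n \<and> Q1 n xs + Q2 n xs \<le> B n) \<longrightarrow>
      length xs = m n \<and> Q1 n xs + Q2 n xs \<le> B n)"
    by (metis empty_subsetI list.set(1))
  then obtain xs where xsF: "\<And>n. set (xs n) \<subseteq> F n" and
    xs: "\<And>n. (\<exists>xs. set xs \<subseteq> F n \<and> length xs = m n \<and> Q1 n xs + Q2 n xs \<le> B n) \<Longrightarrow>
      length (xs n) = m n \<and> Q1 n (xs n) + Q2 n (xs n) \<le> B n" by metis
  have len: "\<forall>\<^sub>F n in sequentially. length (xs n) = m n"
    using ev by eventually_elim (use xs in blast)
  have Q_le: "\<forall>\<^sub>F n in sequentially. Q1 n (xs n) + Q2 n (xs n) \<le> B n"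
    using ev by eventually_elim (use xs in blast)
  have Q_nonneg: "\<forall>\<^sub>F n in sequentially. 0 \<le> Q1 n (xs n) \<and> 0 \<le> Q2 n (xs n)"
    using pos by eventually_elim (auto simp: Q1_def Q2_def intro!: divide_nonneg_nonneg sum_nonneg)
  have Q1_lim: "(\<lambda>n. Q1 n (xs n)) \<longlonglongrightarrow> 0"
    by (rule Lim_null_comparison[OF _ B_lim]) (use Q_le Q_nonneg in \<open>eventually_elim, auto\<close>)
  have Q2_lim: "(\<lambda>n. Q2 n (xs n)) \<longlonglongrightarrow> 0"
    by (rule Lim_null_comparison[OF _ B_lim]) (use Q_le Q_nonneg in \<open>eventually_elim, auto\<close>)

  define W' where "W' n = W n - \<Union>(set (xs n))" for n
  have inner': "inner_edges (E n) (W' n) = {e\<in>F n. e \<inter> \<Union>(set (xs n)) = {}}" for n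
    unfolding inner_edges_def W'_def F_def by blast
  have "(\<lambda>n. (card (W' n) / N n - y * (card (W n) / N n))\<^sup>2) \<longlonglongrightarrow> 0"
    using Q1_lim by (simp add: Q1_def W'_def power_divide[symmetric] diff_divide_distrib)
  from tendsto_add[OF tendsto_zero_of_power2[OF this] tendsto_mult_left[OF W_lim, of y]]
  have W'_lim: "(\<lambda>n. card (W' n) / N n) \<longlonglongrightarrow> x * y" by (simp add: mult.commute)
  define g where "g n v = real (vdeg (inner_edges (E n) (W' n)) v) - (x * y) ^ (k - 1) * D n" for n v
  have "(\<lambda>n. ((\<Sum>v\<in>W' n. \<bar>g n v\<bar>) / (N n * D n))\<^sup>2) \<longlonglongrightarrow> 0"
  proof (rule Lim_null_comparison[OF _ Q2_lim])
    show "\<forall>\<^sub>F n in sequentially. norm (((\<Sum>v\<in>W' n. \<bar>g n v\<bar>) / (N n * D n))\<^sup>2) \<le> Q2 n (xs n)"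
      using pos
    proof eventually_elim
      case (elim n)
      have fin': "finite (W' n)" using finW by (simp add: W'_def)
      have c: "real (card (W' n)) \<le> N n"
        using WV by (auto simp: W'_def intro!: card_mono finV)
      have s: "(\<Sum>v\<in>W' n. (g n v)\<^sup>2) / (N n * (D n)\<^sup>2) = Q2 n (xs n)"
        unfolding Q2_def g_def inner' by (simp add: W'_def d_def power_mult_distrib mult_ac)
      \<comment> \<open>Cauchy-Schwarz against the constant 1 passes from the L2 bound of this round
        to the L1 condition in \<open>quasi_regular\<close>.\<close>
      have "(\<Sum>v\<in>W' n. \<bar>g n v\<bar> * 1)\<^sup>2 \<le> (\<Sum>v\<in>W' n. \<bar>g n v\<bar>\<^sup>2) * (\<Sum>v\<in>W' n. 1\<^sup>2)"
        by (rule Cauchy_Schwarz_ineq_sum)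
      then have "(\<Sum>v\<in>W' n. \<bar>g n v\<bar>)\<^sup>2 \<le> (\<Sum>v\<in>W' n. (g n v)\<^sup>2) * card (W' n)" by simp
      also have "\<dots> \<le> (\<Sum>v\<in>W' n. (g n v)\<^sup>2) * N n"
        using c by (intro mult_left_mono sum_nonneg) auto
      finally have "(\<Sum>v\<in>W' n. \<bar>g n v\<bar>)\<^sup>2 / (N n * D n)\<^sup>2 \<le> ((\<Sum>v\<in>W' n. (g n v)\<^sup>2) * N n) / (N n * D n)\<^sup>2"
        by (intro divide_right_mono) auto
      also have "\<dots> = Q2 n (xs n)"
        unfolding s[symmetric] using elim by (simp add: power2_eq_square)
      finally show ?case by (simp add: power_divide)
    qed
  qed
  then have "quasi_regular (x * y) W'"
    unfolding quasi_regular_def using W'_lim WV tendsto_zero_of_power2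
    by (auto simp: g_def W'_def)
  moreover have "(\<lambda>n. length (xs n) / N n) \<longlonglongrightarrow> \<epsilon> * x / k"
    using m_lim by (rule Lim_transform_eventually) (use len in \<open>eventually_elim, simp\<close>)
  ultimately show ?thesis using xsF unfolding F_def W'_def y_def by blast
qed

text \<open>Round l + 1 starts from density exp(-\<epsilon>)^l and draws that fraction of \<epsilon>
  N / k edges, whence the geometric sum.\<close>

lemma almost_cover:
  assumes \<epsilon>: "\<epsilon> > 0"
  shows "\<exists>xs. (\<forall>n. set (xs n) \<subseteq> E n) \<and>
    (\<lambda>n. length (xs n) / N n) \<longlonglongrightarrow> \<epsilon> / k * (\<Sum>l<j. exp (- \<epsilon>) ^ l) \<and>
    quasi_regular (exp (- \<epsilon>) ^ j) (\<lambda>n. V n - \<Union>(set (xs n)))"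
proof (induction j)
  case 0
  have "inner_edges (E n) (V n) = E n" for n using edge_subset by (auto simp: inner_edges_def)
  moreover have "(\<lambda>n. N n / N n) \<longlonglongrightarrow> 1"
    by (rule Lim_transform_eventually[OF tendsto_const]) (use N_pos in \<open>eventually_elim, simp\<close>)
  ultimately have "quasi_regular 1 V"
    by (simp add: quasi_regular_def regular)
  then show ?case by (intro exI[of _ "\<lambda>_. []"]) simp
next
  case (Suc j)
  then obtain xs where xs: "\<And>n. set (xs n) \<subseteq> E n"
    "(\<lambda>n. length (xs n) / N n) \<longlonglongrightarrow> \<epsilon> / k * (\<Sum>l<j. exp (- \<epsilon>) ^ l)"
    "quasi_regular (exp (- \<epsilon>) ^ j) (\<lambda>n. V n - \<Union>(set (xs n)))" by blast
  have "0 < exp (- \<epsilon>) ^ j" "exp (- \<epsilon>) ^ j \<le> 1" using \<epsilon> by (auto intro!: power_le_one)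
  from quasi_regular_step[OF xs(3) this \<epsilon>] obtain zs where
    zs: "\<And>n. set (zs n) \<subseteq> inner_edges (E n) (V n - \<Union>(set (xs n)))"
    "(\<lambda>n. length (zs n) / N n) \<longlonglongrightarrow> \<epsilon> * exp (- \<epsilon>) ^ j / k"
    "quasi_regular (exp (- \<epsilon>) ^ j * exp (- \<epsilon>)) (\<lambda>n. V n - \<Union>(set (xs n)) - \<Union>(set (zs n)))" by blast
  show ?case
  proof (intro exI[of _ "\<lambda>n. xs n @ zs n"] conjI allI)
    show "set (xs n @ zs n) \<subseteq> E n" for n
      using xs(1)[of n] zs(1)[of n] by (auto simp: inner_edges_def)
    show "(\<lambda>n. length (xs n @ zs n) / N n) \<longlonglongrightarrow> \<epsilon> / k * (\<Sum>l<Suc j. exp (- \<epsilon>) ^ l)"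
      using tendsto_add[OF xs(2) zs(2)] by (simp add: add_divide_distrib distrib_left)
    have "V n - \<Union>(set (xs n @ zs n)) = V n - \<Union>(set (xs n)) - \<Union>(set (zs n))" for n by auto
    then show "quasi_regular (exp (- \<epsilon>) ^ Suc j) (\<lambda>n. V n - \<Union>(set (xs n @ zs n)))"
      using zs(3) by (simp add: mult.commute)
  qed
qed

end

text \<open>Greedy selection: a kept edge enlarges the union by at most k, a rejected one by at most
  k - 1 because it meets a kept edge. Hence the union has at most k |A| + (k - 1) (length - |A|)
  elements.\<close>

lemma disjoint_subfamily:
  assumes "\<And>e. e \<in> set xs \<Longrightarrow> finite e \<and> card e = k" "k > 0"
  shows "\<exists>A\<subseteq>set xs. pairwise disjnt A \<and> card (\<Union>(set xs)) \<le> card A + (k - 1) * length xs"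
  using assms(1)
proof (induction xs)
  case Nil
  then show ?case by simp
next
  case (Cons e xs)
  then obtain A where A: "A \<subseteq> set xs" "pairwise disjnt A"
    "card (\<Union>(set xs)) \<le> card A + (k - 1) * length xs" by auto
  have e: "finite e" "card e = k" and fin: "finite (\<Union>(set xs))" using Cons.prems by auto
  have finA: "finite A" using A finite_subset by blast
  have Un: "\<Union>(set (e # xs)) = \<Union>(set xs) \<union> e" by auto
  show ?case
  proof (cases "e \<inter> \<Union>A = {}")
    case True
    have "e \<noteq> {}" using e assms(2) by auto
    then have "e \<notin> A" using True by blast
    then have "card (insert e A) = Suc (card A)" using finA by simp
    moreover have "card (\<Union>(set xs) \<union> e) \<le> card (\<Union>(set xs)) + k" using card_Un_le e by metis
    ultimately have "card (\<Union>(set (e # xs))) \<le> card (insert e A) + (k - 1) * length (e # xs)"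
      unfolding Un using A(3) assms(2) by simp
    moreover have "pairwise disjnt (insert e A)"
      using A True by (auto simp: pairwise_insert disjnt_def)
    ultimately show ?thesis using A by (intro exI[of _ "insert e A"]) auto
  next
    case False
    then have "e \<inter> \<Union>(set xs) \<noteq> {}" using A by blast
    then have "card (\<Union>(set xs) \<inter> e) > 0" using e by (auto simp: card_gt_0_iff)
    then have "card (\<Union>(set xs) \<union> e) \<le> card (\<Union>(set xs)) + (k - 1)"
      using card_Un_Int[OF fin e(1)] e by simp
    then have "card (\<Union>(set (e # xs))) \<le> card A + (k - 1) * length (e # xs)"
      unfolding Un using A(3) by simp
    then show ?thesis using A by (intro exI[of _ A]) auto
  qed
qed

text \<open>With \<open>y = exp (- \<epsilon>)\<close>, the edges drawn in \<open>j\<close> rounds number at most about \<open>(1 + \<epsilon>) N / k\<close> and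
  miss only \<open>y ^ j N\<close> vertices, so few of them overlap.\<close>

theorem (in regular_hypergraphs) almost_perfect_matching:
  assumes \<eta>: "\<eta> > 0"
  shows "\<forall>\<^sub>F n in sequentially. \<exists>A\<subseteq>E n. pairwise disjnt A \<and> (1 / k - \<eta>) * N n \<le> card A"
proof -
  \<comment> \<open>The loss is below 2 \<epsilon>: one \<epsilon> for the uncovered vertices, one
    for the surplus of drawn edges.\<close>
  define \<epsilon> where "\<epsilon> = \<eta> / 4"
  define y where "y = exp (- \<epsilon>)"
  have \<epsilon>: "\<epsilon> > 0" using \<eta> by (simp add: \<epsilon>_def)
  have y: "0 < y" "y < 1" using \<epsilon> by (auto simp: y_def)
  \<comment> \<open>Bounds the full geometric series \<epsilon> / (1 - y) by 1 + \<epsilon>,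
    uniformly in the number of rounds.\<close>
  have "\<epsilon> \<le> (1 + \<epsilon>) * (1 - y)"
  proof -
    have "(1 + \<epsilon>) * y \<le> exp \<epsilon> * y" using y exp_ge_add_one_self[of \<epsilon>] by (intro mult_right_mono) auto
    then show ?thesis by (simp add: y_def exp_minus algebra_simps)
  qed
  obtain j where j: "y ^ j < \<epsilon>" using real_arch_pow_inv[OF \<epsilon>] y by blast
  obtain xs where xs: "\<And>n. set (xs n) \<subseteq> E n"
    "(\<lambda>n. length (xs n) / N n) \<longlonglongrightarrow> \<epsilon> / k * (\<Sum>l<j. y ^ l)"
    "quasi_regular (y ^ j) (\<lambda>n. V n - \<Union>(set (xs n)))"
    using almost_cover[OF \<epsilon>, of j] unfolding y_def by blast
  have "\<epsilon> * (\<Sum>l<j. y ^ l) \<le> (1 + \<epsilon>) * (1 - y) * (\<Sum>l<j. y ^ l)"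
    using \<open>\<epsilon> \<le> _\<close> y by (intro mult_right_mono sum_nonneg) auto
  also have "\<dots> = (1 + \<epsilon>) * (1 - y ^ j)" using y by (simp add: sum_gp_strict)
  also have "\<dots> \<le> 1 + \<epsilon>" using \<epsilon> y by (simp add: mult_le_cancel_left)
  finally have S: "\<epsilon> * (\<Sum>l<j. y ^ l) \<le> 1 + \<epsilon>" .
  \<comment> \<open>This is the lower bound for |A| / N from \<open>disjoint_subfamily\<close>: the
    covered fraction minus (k - 1) times the relative number of drawn edges.\<close>
  have "(\<lambda>n. (1 - card (V n - \<Union>(set (xs n))) / N n) - (real k - 1) * (length (xs n) / N n))
    \<longlonglongrightarrow> (1 - y ^ j) - (real k - 1) * (\<epsilon> / k * (\<Sum>l<j. y ^ l))"
    using xs unfolding quasi_regular_def by (intro tendsto_intros) auto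
  moreover have "1 / k - \<eta> < (1 - y ^ j) - (real k - 1) * (\<epsilon> / k * (\<Sum>l<j. y ^ l))"
  proof -
    have "(real k - 1) / k * (\<epsilon> * (\<Sum>l<j. y ^ l)) \<le> (real k - 1) / k * (1 + \<epsilon>)"
      using S k_pos by (intro mult_left_mono) auto
    also have "\<dots> = (1 - 1 / k) * 1 + (1 - 1 / k) * \<epsilon>" using k_pos by (simp add: field_simps)
    also have "\<dots> \<le> (1 - 1 / k) * 1 + 1 * \<epsilon>"
      using k_pos \<epsilon> by (intro add_left_mono mult_right_mono) auto
    finally show ?thesis using j \<eta> by (simp add: \<epsilon>_def)
  qed
  ultimately have "\<forall>\<^sub>F n in sequentially. 1 / k - \<eta> <
     (1 - card (V n - \<Union>(set (xs n))) / N n) - (real k - 1) * (length (xs n) / N n)"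
    by (rule order_tendstoD)
  then show ?thesis using N_pos
  proof eventually_elim
    case (elim n)
    have edge: "finite e \<and> card e = k" if "e \<in> set (xs n)" for e
      using that xs(1) EV finV finite_subset by (metis subsetD)
    from disjoint_subfamily[OF edge k_pos] obtain A where A: "A \<subseteq> set (xs n)" "pairwise disjnt A"
      "card (\<Union>(set (xs n))) \<le> card A + (k - 1) * length (xs n)" by blast
    have U: "\<Union>(set (xs n)) \<subseteq> V n" using xs(1) EV by blast
    have "card (V n) = card (V n - \<Union>(set (xs n))) + card (\<Union>(set (xs n)))"
      using U finV by (metis card_Diff_subset card_mono finite_subset le_add_diff_inverse2)
    then have c: "N n = real (card (V n - \<Union>(set (xs n)))) + card (\<Union>(set (xs n)))" by simp
    have "real (card (\<Union>(set (xs n)))) \<le> card A + (real k - 1) * length (xs n)"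
    proof -
      have "real (k - 1) = real k - 1" using k_pos by (simp add: of_nat_diff)
      then show ?thesis using of_nat_mono[OF A(3), where 'a = real] by simp
    qed
    moreover have "(1 / k - \<eta>) * N n \<le> ((1 - card (V n - \<Union>(set (xs n))) / N n) - (real k - 1) * (length (xs n) / N n)) * N n"
      using elim by (intro mult_right_mono) auto
    moreover have "\<dots> = N n - card (V n - \<Union>(set (xs n))) - (real k - 1) * length (xs n)"
      using elim by (simp add: field_simps)
    ultimately have "(1 / k - \<eta>) * N n \<le> card A" using c by linarith
    then show ?case using A xs(1)[of n] by (intro exI[of _ A]) auto
  qed
qed

section \<open>Cliques in uniform hypergraphs\<close>

definition cliques :: "nat \<Rightarrow> nat \<Rightarrow> 'a set set \<Rightarrow> 'a set set" where
  "cliques p q G = {T. card T = q \<and> (\<forall>S\<subseteq>T. card S = p \<longrightarrow> S \<in> G)}"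

lemma gbinomial_Suc_mult:
  fixes a :: real
  shows "real (Suc k) * (a gchoose Suc k) = (a - k) * (a gchoose k)"
  using gbinomial_mult_1[of a k] by (simp add: algebra_simps)

lemma gbinomial_nonneg_real:
  fixes a :: real
  assumes "real k - 1 \<le> a"
  shows "0 \<le> a gchoose k"
  unfolding gbinomial_prod_rev using assms by (intro divide_nonneg_nonneg prod_nonneg) auto

lemma gbinomial_mono_real:
  fixes a b :: real
  assumes "real k - 1 \<le> a" "a \<le> b"
  shows "a gchoose k \<le> b gchoose k"
  unfolding gbinomial_prod_rev using assms by (intro divide_right_mono prod_mono) auto

text \<open>Lets any positive degree below the threshold be written as a binomial coefficient with
  real upper entry, as the induction hypothesis for a link demands.\<close>

lemma gbinomial_eq_nat_exists:
  fixes x :: real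
  assumes "1 \<le> d" "real d \<le> x gchoose p" "real p \<le> x"
  shows "\<exists>z. real p \<le> z \<and> z \<le> x \<and> z gchoose p = real d"
proof -
  have "real p gchoose p = 1" using binomial_gbinomial[of p p, where 'a = real] by simp
  then have "real p gchoose p \<le> real d" using assms by simp
  moreover have "continuous_on {real p..x} (\<lambda>z. z gchoose p)"
    unfolding gbinomial_prod_rev by (intro continuous_intros) auto
  ultimately show ?thesis using IVT'[of "\<lambda>z. z gchoose p" "real p" "real d" x] assms by auto
qed

lemma clique_subset_Union:
  assumes T: "T \<in> cliques p q G" and p: "1 \<le> p" "p \<le> q"
  shows "T \<subseteq> \<Union>G"
proof
  fix v assume v: "v \<in> T"
  have "card T = q" using T by (simp add: cliques_def)
  then have fin: "finite T" using p card.infinite by fastforce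
  have "p - 1 \<le> card (T - {v})" using v \<open>card T = q\<close> p by simp
  then obtain S where S: "S \<subseteq> T - {v}" "card S = p - 1" using obtain_subset_with_card_n by metis
  have "finite S" using S fin finite_subset by blast
  moreover have "v \<notin> S" using S by auto
  ultimately have "card (insert v S) = p" using S p by simp
  moreover have "insert v S \<subseteq> T" using S v by auto
  ultimately have "insert v S \<in> G" using T unfolding cliques_def by blast
  then show "v \<in> \<Union>G" by blast
qed

lemma finite_cliques:
  assumes "finite G" "\<And>e. e \<in> G \<Longrightarrow> finite e" "1 \<le> p" "p \<le> q"
  shows "finite (cliques p q G)"
proof (rule finite_subset)
  show "cliques p q G \<subseteq> Pow (\<Union>G)" using clique_subset_Union assms by blast
qed (use assms in auto)

text \<open>Keevash's proof of the Lovasz form of the Kruskal--Katona theorem: a vertex \<open>v\<close> of degree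
  \<open>d\<close> lies in at most \<open>(x / p - 1) d\<close> of the cliques. If \<open>d\<close> is large this holds since removing
  \<open>v\<close> from a clique leaves an edge avoiding \<open>v\<close>, and otherwise by induction for the link of \<open>v\<close>.\<close>

lemma card_cliques_Suc_le:
  fixes x :: real
  assumes "finite G" "\<And>e. e \<in> G \<Longrightarrow> card e = p" "1 \<le> p" "real p \<le> x" "real (card G) \<le> x gchoose p"
  shows "real (card (cliques p (Suc p) G)) \<le> x gchoose Suc p"
  using assms(3,1,2,4,5)
proof (induction p arbitrary: G x rule: nat_induct_at_least)
  case (base G x)
  have finU: "finite (\<Union>G)" using base by (intro finite_Union) (auto intro: card_ge_0_finite)
  have "G = (\<lambda>v. {v}) ` \<Union>G"
  proof (intro equalityI subsetI)
    fix e assume e: "e \<in> G"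
    then obtain v where "e = {v}" using base card_1_singletonE by metis
    then show "e \<in> (\<lambda>v. {v}) ` \<Union>G" using e by auto
  next
    fix e assume "e \<in> (\<lambda>v. {v}) ` \<Union>G"
    then obtain v f where vf: "e = {v}" "v \<in> f" "f \<in> G" by auto
    then obtain u where "f = {u}" using base card_1_singletonE by metis
    then show "e \<in> G" using vf by simp
  qed
  then have cU: "card (\<Union>G) = card G" using card_image[of "\<lambda>v. {v}" "\<Union>G"] by simp
  have "cliques 1 (Suc 1) G \<subseteq> {T. T \<subseteq> \<Union>G \<and> card T = 2}"
    using clique_subset_Union[of _ 1 2 G] by (auto simp: cliques_def numeral_2_eq_2)
  then have "card (cliques 1 (Suc 1) G) \<le> card (\<Union>G) choose 2"
    using card_mono[of "{T. T \<subseteq> \<Union>G \<and> card T = 2}"] finU n_subsets[OF finU, of 2] by simp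
  then have "real (card (cliques 1 (Suc 1) G)) \<le> real (card G) gchoose 2"
    unfolding cU binomial_gbinomial[symmetric] by simp
  also have "\<dots> \<le> x gchoose 2"
  \<comment> \<open>Monotonicity of z choose 2 is available only from z = 1 on, so the empty
    \<open>G\<close> is treated apart.\<close>
  proof (cases "card G = 0")
    case True
    then show ?thesis using gbinomial_nonneg_real[of 2 x] base by (simp add: gbinomial_0_left)
  next
    case False
    then have "1 \<le> real (card G)" by linarith
    then show ?thesis using base.prems by (intro gbinomial_mono_real) simp_all
  qed
  finally show ?case by (simp add: numeral_2_eq_2)
next
  case (Suc p G x)
  define U where "U = \<Union>G"
  define K where "K = cliques (Suc p) (Suc (Suc p)) G"
  have finU: "finite U"
    using Suc.prems unfolding U_def by (intro finite_Union) (auto intro: card_ge_0_finite)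
  have fin_edge: "finite e" if "e \<in> G" for e using Suc.prems that by (auto intro!: card_ge_0_finite)
  have K_sub: "T \<subseteq> U" "card T = Suc (Suc p)" if "T \<in> K" for T
    using that clique_subset_Union[of T "Suc p" "Suc (Suc p)" G] by (auto simp: K_def U_def cliques_def)
  have finK: "finite K"
    unfolding K_def using finite_cliques[OF Suc.prems(1) fin_edge] by simp
  have finT: "finite T" if "T \<in> K" for T using K_sub[OF that] finU finite_subset by blast
  have p: "p \<ge> 1" by fact
  have v_bound: "real (vdeg K v) \<le> (x / Suc p - 1) * vdeg G v" for v
  proof -
    define Kv where "Kv = {T\<in>K. v \<in> T}"
    define link where "link = (\<lambda>e. e - {v}) ` {e\<in>G. v \<in> e}"
    have inj: "inj_on (\<lambda>e. e - {v}) {e. v \<in> e}" by (rule inj_onI) blast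
    have card_link: "card link = vdeg G v"
      unfolding link_def vdeg_def by (intro card_image inj_on_subset[OF inj]) auto
    have link: "finite link" "\<And>e. e \<in> link \<Longrightarrow> card e = p"
      using Suc.prems fin_edge by (auto simp: link_def)
    have link_edge: "finite e" if "e \<in> link" for e using that fin_edge by (auto simp: link_def)
    have card_Kv: "card ((\<lambda>T. T - {v}) ` Kv) = vdeg K v"
      unfolding Kv_def vdeg_def by (intro card_image inj_on_subset[OF inj]) auto
    have "(\<lambda>T. T - {v}) ` Kv \<subseteq> cliques p (Suc p) link"
    proof
      fix T' assume "T' \<in> (\<lambda>T. T - {v}) ` Kv"
      then obtain T where T: "T \<in> K" "v \<in> T" "T' = T - {v}" by (auto simp: Kv_def)
      have "S \<in> link" if S: "S \<subseteq> T - {v}" "card S = p" for S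
      proof -
        have "finite S" "v \<notin> S" using S finT[OF T(1)] finite_subset by auto
        moreover have "insert v S \<subseteq> T" using T S by auto
        ultimately have "insert v S \<in> G"
          using T(1) S(2) unfolding K_def cliques_def by (simp add: card_insert_disjoint)
        then have "insert v S - {v} \<in> link" by (auto simp: link_def)
        then show ?thesis using \<open>v \<notin> S\<close> by simp
      qed
      then show "T' \<in> cliques p (Suc p) link"
        using T K_sub[OF T(1)] finT[OF T(1)] by (auto simp: cliques_def)
    qed
    then have le_link: "vdeg K v \<le> card (cliques p (Suc p) link)"
      unfolding card_Kv[symmetric] using finite_cliques[OF link(1) link_edge p]
      by (intro card_mono) auto
    have "(\<lambda>T. T - {v}) ` Kv \<subseteq> G - {e\<in>G. v \<in> e}"
    proof
      fix T' assume "T' \<in> (\<lambda>T. T - {v}) ` Kv"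
      then obtain T where T: "T \<in> K" "v \<in> T" "T' = T - {v}" by (auto simp: Kv_def)
      then have "card T' = Suc p" using K_sub[OF T(1)] finT[OF T(1)] by simp
      moreover have "T' \<subseteq> T" using T by auto
      ultimately have "T' \<in> G" using T(1) unfolding K_def cliques_def by blast
      then show "T' \<in> G - {e\<in>G. v \<in> e}" using T by auto
    qed
    then have "vdeg K v \<le> card (G - {e\<in>G. v \<in> e})"
      unfolding card_Kv[symmetric] using Suc.prems by (intro card_mono) auto
    also have "\<dots> = card G - vdeg G v"
      unfolding vdeg_def using Suc.prems by (intro card_Diff_subset) auto
    finally have le_diff: "real (vdeg K v) \<le> real (card G) - vdeg G v"
      using card_mono[of G "{e\<in>G. v \<in> e}"] Suc.prems by (simp add: vdeg_def)
    show ?thesis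
    \<comment> \<open>At this threshold both estimates give the same value: by Pascal's rule
      C(x,p+1) - C(x-1,p) = C(x-1,p+1), which is x / (p+1) - 1 times C(x-1,p).\<close>
    proof (cases "(x - 1) gchoose p \<le> real (vdeg G v)")
      case True
      have "real (vdeg K v) \<le> (x gchoose Suc p) - ((x - 1) gchoose p)"
        using le_diff True Suc.prems by simp
      also have "\<dots> = (x - 1) gchoose Suc p"
        using gbinomial_Suc_Suc[of "x - 1" p] by simp
      also have "\<dots> = (x / Suc p - 1) * ((x - 1) gchoose p)"
        using gbinomial_Suc_mult[of p "x - 1"] by (simp add: field_simps)
      also have "\<dots> \<le> (x / Suc p - 1) * vdeg G v"
        using True Suc.prems by (intro mult_left_mono) (auto simp: field_simps)
      finally show ?thesis .
    next
      case False
      show ?thesis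
      proof (cases "vdeg G v = 0")
        case True
        then have "link = {}" using card_link link by simp
        have "False" if "T \<in> cliques p (Suc p) link" for T
          using clique_subset_Union[OF that p] that \<open>link = {}\<close> by (simp add: cliques_def)
        then have "cliques p (Suc p) link = {}" by blast
        then show ?thesis using True le_link by simp
      next
        case F: False
        \<comment> \<open>The induction hypothesis at \<open>z\<close> gives the factor (z + 1) / (p
          + 1) - 1, and z + 1 is at most x.\<close>
        obtain z where z: "real p \<le> z" "z \<le> x - 1" "z gchoose p = real (vdeg G v)"
          using gbinomial_eq_nat_exists[of "vdeg G v" "x - 1" p] False F Suc.prems by auto
        have "real (vdeg K v) \<le> z gchoose Suc p"
          using le_link Suc.IH[OF link z(1)] z(3) card_link by simp
        also have "\<dots> = ((z + 1) / Suc p - 1) * vdeg G v"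
          using gbinomial_Suc_mult[of p z] z(3) by (simp add: field_simps)
        also have "\<dots> \<le> (x / Suc p - 1) * vdeg G v"
          using z by (intro mult_right_mono) (auto simp: divide_right_mono)
        finally show ?thesis .
      qed
    qed
  qed
  have "(\<Sum>v\<in>U. vdeg G v) = Suc p * card G"
    by (rule sum_vdeg[OF finU]) (use Suc.prems in \<open>auto simp: U_def\<close>)
  from arg_cong[OF this, of real] have sumG: "(\<Sum>v\<in>U. real (vdeg G v)) = real (Suc p * card G)"
    by (simp only: of_nat_sum)
  have "real (Suc (Suc p)) * card K = (\<Sum>v\<in>U. real (vdeg K v))"
    using arg_cong[OF sum_vdeg[OF finU, of K "Suc (Suc p)"], of real] K_sub by (simp add: algebra_simps)
  also have "\<dots> \<le> (\<Sum>v\<in>U. (x / Suc p - 1) * vdeg G v)" by (intro sum_mono v_bound)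
  also have "\<dots> = (x / Suc p - 1) * (Suc p * card G)"
    unfolding sum_distrib_left[symmetric] sumG by simp
  also have "\<dots> = (x - Suc p) * card G" by (simp add: field_simps)
  also have "\<dots> \<le> (x - Suc p) * (x gchoose Suc p)"
    using Suc.prems by (intro mult_left_mono) auto
  also have "\<dots> = real (Suc (Suc p)) * (x gchoose Suc (Suc p))"
    by (rule gbinomial_Suc_mult[symmetric])
  finally show ?case unfolding K_def by (simp only: mult_le_cancel_left_pos of_nat_0_less_iff zero_less_Suc)
qed

text \<open>Raise the clique size one step at a time: the q-cliques form a q-graph, and every
  (q+1)-clique of \<open>G\<close> is one of that q-graph too. The parameter \<open>a\<close> stays
  the same throughout.\<close>

theorem card_cliques_le:
  assumes "finite G" "\<And>e. e \<in> G \<Longrightarrow> card e = p" "1 \<le> p" "p \<le> q" "q \<le> a" "card G \<le> a choose p"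
  shows "card (cliques p q G) \<le> a choose q"
  using assms(4,5)
proof (induction q rule: dec_induct)
  case base
  have "cliques p p G \<subseteq> G" by (auto simp: cliques_def)
  from card_mono[OF assms(1) this] show ?case using assms(6) by linarith
next
  case (step q)
  define G' where "G' = cliques p q G"
  have finG': "finite G'"
    unfolding G'_def using assms step by (intro finite_cliques) (auto intro!: card_ge_0_finite)
  have sub: "cliques p (Suc q) G \<subseteq> cliques q (Suc q) G'" by (auto simp: cliques_def G'_def)
  have cardG': "card e = q" if "e \<in> G'" for e using that by (simp add: G'_def cliques_def)
  have "finite (cliques q (Suc q) G')"
    using finG' cardG' step assms by (intro finite_cliques) (auto intro!: card_ge_0_finite)
  then have "real (card (cliques p (Suc q) G)) \<le> card (cliques q (Suc q) G')"
    using sub by (simp add: card_mono)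
  also have "\<dots> \<le> real a gchoose Suc q"
    using step assms by (intro card_cliques_Suc_le finG' cardG')
      (auto simp: binomial_gbinomial[symmetric] G'_def)
  also have "\<dots> = real (a choose Suc q)" by (simp add: binomial_gbinomial)
  finally show ?case by simp
qed

section \<open>Packings and the extremal function\<close>

definition subsets_of_size :: "nat \<Rightarrow> 'a set \<Rightarrow> 'a set set" where
  "subsets_of_size i A = {I. I \<subseteq> A \<and> card I = i}"

lemma finite_subsets_of_size: "finite A \<Longrightarrow> finite (subsets_of_size i A)"
  by (simp add: subsets_of_size_def)

lemma card_subsets_of_size: "finite A \<Longrightarrow> card (subsets_of_size i A) = card A choose i"
  by (simp add: subsets_of_size_def n_subsets)

lemma card_supersets_of_size:
  assumes "finite A" "B \<subseteq> A" "card B \<le> r"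
  shows "card {e \<in> subsets_of_size r A. B \<subseteq> e} = (card A - card B) choose (r - card B)"
proof -
  have finB: "finite B" using assms finite_subset by blast
  have "bij_betw (\<lambda>e. e - B) {e \<in> subsets_of_size r A. B \<subseteq> e} (subsets_of_size (r - card B) (A - B))"
  proof (rule bij_betwI[where g = "\<lambda>e. e \<union> B"])
    show "(\<lambda>e. e - B) \<in> {e \<in> subsets_of_size r A. B \<subseteq> e} \<rightarrow> subsets_of_size (r - card B) (A - B)"
      using finB by (auto simp: subsets_of_size_def card_Diff_subset)
    show "(\<lambda>e. e \<union> B) \<in> subsets_of_size (r - card B) (A - B) \<rightarrow> {e \<in> subsets_of_size r A. B \<subseteq> e}"
    proof
      fix e assume e: "e \<in> subsets_of_size (r - card B) (A - B)"
      then have "finite e" "e \<inter> B = {}" using assms finite_subset by (auto simp: subsets_of_size_def)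
      then have "card (e \<union> B) = card e + card B" using finB by (simp add: card_Un_disjoint)
      then show "e \<union> B \<in> {e \<in> subsets_of_size r A. B \<subseteq> e}"
        using e assms by (auto simp: subsets_of_size_def)
    qed
  qed (auto simp: subsets_of_size_def)
  then have "card {e \<in> subsets_of_size r A. B \<subseteq> e} = card (subsets_of_size (r - card B) (A - B))"
    by (rule bij_betw_same_card)
  then show ?thesis using assms finB by (simp add: card_subsets_of_size card_Diff_subset)
qed

text \<open>For 1 <= i <= r an r-set is the union of its i-subsets. Edges of the packing hypergraph
  can therefore be counted as r-sets.\<close>

lemma inj_on_subsets_of_size:
  assumes "1 \<le> i" "i \<le> r"
  shows "inj_on (subsets_of_size i) (subsets_of_size r A)"
proof -
  have un: "\<Union>(subsets_of_size i e) = e" if e: "card e = r" for e :: "'a set"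
  proof (intro equalityI subsetI)
    fix v assume v: "v \<in> e"
    have "i - 1 \<le> card (e - {v})" using v e assms by simp
    then obtain I where I: "I \<subseteq> e - {v}" "card I = i - 1" using obtain_subset_with_card_n by metis
    have "finite e" using e assms by (intro card_ge_0_finite) simp
    then have "finite I" "v \<notin> I" using I finite_subset by auto
    then have "insert v I \<in> subsets_of_size i e" using I v assms by (auto simp: subsets_of_size_def)
    then show "v \<in> \<Union>(subsets_of_size i e)" by blast
  qed (auto simp: subsets_of_size_def)
  show ?thesis
    by (rule inj_onI) (metis (mono_tags, lifting) mem_Collect_eq subsets_of_size_def un)
qed

lemma binomial_at_top:
  assumes "1 \<le> i"
  shows "filterlim (\<lambda>n. real (n choose i)) at_top sequentially"
proof (rule filterlim_at_top_mono)
  show "filterlim (\<lambda>n. real n / i) at_top sequentially"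
    using assms filterlim_tendsto_pos_mult_at_top[OF tendsto_const[of "1 / real i"] _ filterlim_real_sequentially]
    by simp
  show "\<forall>\<^sub>F n in sequentially. real n / i \<le> real (n choose i)"
    using eventually_ge_at_top[of i]
  proof eventually_elim
    case (elim n)
    have "real n / i \<le> (real n / i) ^ i"
      using elim assms self_le_power[of "real n / i" i] by simp
    also have "\<dots> \<le> real (n choose i)"
      using binomial_ge_n_over_k_pow_k[OF elim, where 'a = real] by simp
    finally show ?case .
  qed
qed

text \<open>Apply the matching theorem to the hypergraph whose vertices are the \<open>i\<close>-sets and whose edges
  are the families of all \<open>i\<close>-subsets of an \<open>r\<close>-set.\<close>

theorem roedl_packing:
  assumes i: "1 \<le> i" and ir: "i < r" and \<eta>: "\<eta> > 0"
  shows "\<forall>\<^sub>F n in sequentially. \<exists>P\<subseteq>subsets_of_size r {..<n}.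
    (\<forall>e\<in>P. \<forall>f\<in>P. e \<noteq> f \<longrightarrow> card (e \<inter> f) < i) \<and>
    (1 / (r choose i) - \<eta>) * (n choose i) \<le> card P"
proof -
  define V where "V n = subsets_of_size i {..<n}" for n :: nat
  define E where "E n = subsets_of_size i ` subsets_of_size r {..<n}" for n :: nat
  define D where "D n = real ((n - i) choose (r - i))" for n :: nat
  define C where "C n = real ((n - Suc i) choose (r - Suc i))" for n :: nat
  note inj = inj_on_subsets_of_size[OF i less_imp_le[OF ir]]
  have cardV: "card (V n) = n choose i" for n by (simp add: V_def card_subsets_of_size)
  have deg_eq: "card {X \<in> E n. \<Phi> X} = card {e \<in> subsets_of_size r {..<n}. \<Phi> (subsets_of_size i e)}" for \<Phi> n
  proof -
    have "{X \<in> E n. \<Phi> X} = subsets_of_size i ` {e \<in> subsets_of_size r {..<n}. \<Phi> (subsets_of_size i e)}"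
      by (auto simp: E_def)
    then show ?thesis using card_image[OF inj_on_subset[OF inj]] by (metis (no_types, lifting) mem_Collect_eq subsetI)
  qed
  interpret regular_hypergraphs V E "r choose i" D C
  proof unfold_locales
    show "finite (V n)" for n by (simp add: V_def finite_subsets_of_size)
    show "X \<subseteq> V n \<and> card X = (r choose i)" if XE: "X \<in> E n" for X n
    proof -
      obtain e where X: "X = subsets_of_size i e" and "e \<in> subsets_of_size r {..<n}"
        using XE unfolding E_def by blast
      then have e: "e \<subseteq> {..<n}" "card e = r" by (auto simp: subsets_of_size_def)
      then have "finite e" using finite_subset by blast
      moreover have "X \<subseteq> V n" using e(1) by (auto simp: X V_def subsets_of_size_def)
      ultimately show ?thesis using e(2) by (simp add: X card_subsets_of_size)
    qed
    show "0 < r choose i" using ir by simp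
    show "real (vdeg (E n) I) = D n" if I: "I \<in> V n" for I n
    proof -
      have I': "I \<subseteq> {..<n}" "card I = i" using I by (auto simp: V_def subsets_of_size_def)
      have "vdeg (E n) I = card {e \<in> subsets_of_size r {..<n}. I \<subseteq> e}"
        unfolding vdeg_def deg_eq using I' by (simp add: subsets_of_size_def)
      then show ?thesis using card_supersets_of_size[of "{..<n}" I r] I' ir by (simp add: D_def)
    qed
    show "real (codeg (E n) I J) \<le> C n" if IJ: "I \<in> V n" "J \<in> V n" "I \<noteq> J" for I J n
    proof -
      have I': "I \<subseteq> {..<n}" "card I = i" "J \<subseteq> {..<n}" "card J = i"
        using IJ by (auto simp: V_def subsets_of_size_def)
      then have fin: "finite I" "finite J" using finite_subset by blast+
      \<comment> \<open>Distinct i-sets have a union of at least i + 1 elements, so an r-set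
        containing both contains \<open>I\<close> and a further point.\<close>
      then have "\<not> J \<subseteq> I" using IJ(3) I' card_subset_eq by metis
      then obtain v where v: "v \<in> J" "v \<notin> I" by blast
      have "codeg (E n) I J = card {e \<in> subsets_of_size r {..<n}. I \<subseteq> e \<and> J \<subseteq> e}"
        unfolding codeg_def deg_eq using I' by (simp add: subsets_of_size_def)
      also have "\<dots> \<le> card {e \<in> subsets_of_size r {..<n}. insert v I \<subseteq> e}"
        using v by (intro card_mono) (auto simp: finite_subsets_of_size)
      also have "\<dots> = (n - Suc i) choose (r - Suc i)"
        using card_supersets_of_size[of "{..<n}" "insert v I" r] I' v fin ir by auto
      finally show ?thesis by (simp add: C_def)
    qed
    show "0 \<le> C n" for n by (simp add: C_def)
    show "\<forall>\<^sub>F n in sequentially. 0 < D n"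
      using eventually_ge_at_top[of r] by eventually_elim (simp add: D_def)
    show "(\<lambda>n. C n / D n) \<longlonglongrightarrow> 0"
    proof (rule Lim_transform_eventually)
      have "filterlim (\<lambda>n. - real i + real n) at_top sequentially"
        by (rule filterlim_tendsto_add_at_top[OF tendsto_const filterlim_real_sequentially])
      then show "(\<lambda>n. real (r - i) / (- real i + real n)) \<longlonglongrightarrow> 0"
        by (intro tendsto_divide_0[OF tendsto_const] filterlim_at_top_imp_at_infinity)
      show "\<forall>\<^sub>F n in sequentially. real (r - i) / (- real i + real n) = C n / D n"
        using eventually_ge_at_top[of r]
      proof eventually_elim
        case (elim n)
        obtain a where a: "r - i = Suc a" using ir by (metis Suc_diff_Suc)
        obtain b where b: "n - i = Suc b" using elim ir by (metis Suc_diff_Suc order_less_le_trans)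
        have ab: "r - Suc i = a" "n - Suc i = b" "a \<le> b" using a b elim by auto
        have "- real i + real n = Suc b" using b by linarith
        \<comment> \<open>The absorption identity makes C/D exactly (r - i) / (n - i).\<close>
        have "real (Suc a) * (Suc b choose Suc a) = real (Suc b) * (b choose a)"
          using Suc_times_binomial_eq[of b a] by (metis of_nat_mult mult.commute)
        moreover have "0 < Suc b choose Suc a" using ab by simp
        ultimately have "real (Suc a) / real (Suc b) = real (b choose a) / real (Suc b choose Suc a)"
          by (simp add: frac_eq_eq mult.commute del: binomial_Suc_Suc of_nat_Suc)
        then show ?case using \<open>- real i + real n = Suc b\<close> unfolding C_def D_def a b ab by simp
      qed
    qed
    show "filterlim (\<lambda>n. real (card (V n))) at_top sequentially"
      unfolding cardV using i by (rule binomial_at_top)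
  qed
  from almost_perfect_matching[OF \<eta>] show ?thesis
  proof eventually_elim
    case (elim n)
    then obtain A where A: "A \<subseteq> E n" "pairwise disjnt A" "(1 / (r choose i) - \<eta>) * (n choose i) \<le> card A"
      unfolding cardV by blast
    obtain P where P: "P \<subseteq> subsets_of_size r {..<n}" "A = subsets_of_size i ` P"
      using A(1) unfolding E_def by (auto simp: subset_image_iff)
    have injP: "inj_on (subsets_of_size i) P" using inj P inj_on_subset by blast
    \<comment> \<open>A common i-subset would be a common vertex of two members of the
      matching.\<close>
    have "card (e \<inter> f) < i" if ef: "e \<in> P" "f \<in> P" "e \<noteq> f" for e f
    proof (rule ccontr)
      assume "\<not> card (e \<inter> f) < i"
      then obtain I where "I \<subseteq> e \<inter> f" "card I = i" using obtain_subset_with_card_n by (metis not_less)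
      then have "I \<in> subsets_of_size i e" "I \<in> subsets_of_size i f" by (auto simp: subsets_of_size_def)
      moreover have "disjnt (subsets_of_size i e) (subsets_of_size i f)"
        using ef inj_onD[OF injP] by (intro pairwiseD[OF A(2)[unfolded P(2)]] imageI) auto
      ultimately show False by (auto simp: disjnt_def)
    qed
    moreover have "card A = card P" unfolding P using injP by (rule card_image)
    ultimately show ?case using P(1) A(3) by (intro exI[of _ P]) auto
  qed
qed

section \<open>Upper and lower bounds for the extremal function\<close>

lemma deg_le_Delta:
  assumes "I \<subseteq> {..<n}" "card I = i"
  shows "deg H I \<le> Delta n i H"
proof -
  have "{deg H I |I. I \<subseteq> {..<n} \<and> card I = i} = deg H ` subsets_of_size i {..<n}"
    by (auto simp: subsets_of_size_def)
  then show ?thesis unfolding Delta_def using assms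
    by (intro Max_ge) (auto simp: finite_subsets_of_size)
qed

text \<open>The condition i <= n ensures that the maximum is over a nonempty set of degrees.\<close>

lemma Delta_le:
  assumes "i \<le> n" "\<And>I. I \<subseteq> {..<n} \<Longrightarrow> card I = i \<Longrightarrow> deg H I \<le> d"
  shows "Delta n i H \<le> d"
proof -
  have eq: "{deg H I |I. I \<subseteq> {..<n} \<and> card I = i} = deg H ` subsets_of_size i {..<n}"
    by (auto simp: subsets_of_size_def)
  have "{..<i} \<in> subsets_of_size i {..<n}" using assms by (auto simp: subsets_of_size_def)
  then have "subsets_of_size i {..<n} \<noteq> {}" by blast
  then show ?thesis unfolding Delta_def eq using assms(2)
    by (intro Max.boundedI) (auto simp: finite_subsets_of_size subsets_of_size_def)
qed

lemma kt_upper_bound: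
  assumes i: "1 \<le> i" "i < s" "s \<le> t" "t \<le> r" and H: "sgraph n s H" "Delta n i H \<le> (r - i) choose (s - i)"
  shows "kt n s t H * (t choose i) \<le> (n choose i) * ((r - i) choose (t - i))"
proof -
  define KT where "KT = {T. T \<subseteq> {..<n} \<and> card T = t \<and> (\<forall>S. S \<subseteq> T \<and> card S = s \<longrightarrow> S \<in> H)}"
  have finKT: "finite KT" by (rule finite_subset[of _ "Pow {..<n}"]) (auto simp: KT_def)
  have finH: "finite H" by (rule finite_subset[of _ "Pow {..<n}"]) (use H in \<open>auto simp: sgraph_def\<close>)
  have fin: "finite A" if "A \<subseteq> {..<n}" for A :: "nat set" using that finite_subset by blast
  have local_bound: "card {T\<in>KT. I \<subseteq> T} \<le> (r - i) choose (t - i)" if I: "I \<in> subsets_of_size i {..<n}" for I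
  proof -
    have I': "I \<subseteq> {..<n}" "card I = i" "finite I" using I fin by (auto simp: subsets_of_size_def)
    define link where "link = (\<lambda>e. e - I) ` {e\<in>H. I \<subseteq> e}"
    have inj: "inj_on (\<lambda>e. e - I) {e. I \<subseteq> e}" by (rule inj_onI) blast
    have "card link = deg H I"
      unfolding link_def deg_def by (intro card_image inj_on_subset[OF inj]) auto
    also have "\<dots> \<le> (r - i) choose (s - i)" using deg_le_Delta[OF I'(1,2)] H(2) by (rule order.trans)
    finally have card_link: "card link \<le> (r - i) choose (s - i)" .
    have link: "finite link" "\<And>e. e \<in> link \<Longrightarrow> card e = s - i"
      using finH H(1) I' by (auto simp: link_def sgraph_def card_Diff_subset)
    have "(\<lambda>T. T - I) ` {T\<in>KT. I \<subseteq> T} \<subseteq> cliques (s - i) (t - i) link"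
    proof
      fix T' assume "T' \<in> (\<lambda>T. T - I) ` {T\<in>KT. I \<subseteq> T}"
      then obtain T where T: "T \<in> KT" "I \<subseteq> T" "T' = T - I" by auto
      have "S \<in> link" if S: "S \<subseteq> T - I" "card S = s - i" for S
      proof -
        have "finite S" using S T fin finite_subset unfolding KT_def by (metis (no_types, lifting) finite_Diff mem_Collect_eq)
        moreover have "S \<inter> I = {}" using S by auto
        ultimately have "card (S \<union> I) = s" using I' S i by (simp add: card_Un_disjoint)
        moreover have "S \<union> I \<subseteq> T" using S T by auto
        ultimately have "S \<union> I \<in> H" using T(1) by (simp add: KT_def)
        then have "(S \<union> I) - I \<in> link" by (auto simp: link_def)
        moreover have "(S \<union> I) - I = S" using \<open>S \<inter> I = {}\<close> by auto
        ultimately show ?thesis by simp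
      qed
      moreover have "card T' = t - i" using T I' by (simp add: card_Diff_subset KT_def)
      ultimately show "T' \<in> cliques (s - i) (t - i) link" using T by (simp add: cliques_def)
    qed
    moreover have "finite (cliques (s - i) (t - i) link)"
      using link i by (intro finite_cliques) (auto intro!: card_ge_0_finite)
    ultimately have "card ((\<lambda>T. T - I) ` {T\<in>KT. I \<subseteq> T}) \<le> card (cliques (s - i) (t - i) link)"
      by (intro card_mono)
    \<comment> \<open>Since i < s, the link has edges of size s - i >= 1, as Kruskal-Katona requires
      here.\<close>
    also have "\<dots> \<le> (r - i) choose (t - i)"
      using i by (intro card_cliques_le link card_link) auto
    also have "card ((\<lambda>T. T - I) ` {T\<in>KT. I \<subseteq> T}) = card {T\<in>KT. I \<subseteq> T}"
      by (intro card_image inj_on_subset[OF inj]) auto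
    finally show ?thesis .
  qed
  have "kt n s t H * (t choose i) = (\<Sum>T\<in>KT. t choose i)" by (simp add: kt_def KT_def)
  also have "\<dots> = (\<Sum>T\<in>KT. card {I \<in> subsets_of_size i {..<n}. I \<subseteq> T})"
  proof (intro sum.cong refl)
    fix T assume "T \<in> KT"
    then have T: "T \<subseteq> {..<n}" "card T = t" by (auto simp: KT_def)
    then have "{I \<in> subsets_of_size i {..<n}. I \<subseteq> T} = subsets_of_size i T" by (auto simp: subsets_of_size_def)
    then show "t choose i = card {I \<in> subsets_of_size i {..<n}. I \<subseteq> T}"
      using T fin by (simp add: card_subsets_of_size)
  qed
  also have "\<dots> = (\<Sum>I\<in>subsets_of_size i {..<n}. card {T\<in>KT. I \<subseteq> T})"
    using sum.swap_restrict[OF finKT finite_subsets_of_size[of "{..<n}" i], of "\<lambda>_ _. 1::nat" "\<lambda>T I. I \<subseteq> T"] by simp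
  also have "\<dots> \<le> (\<Sum>I\<in>subsets_of_size i {..<n}. (r - i) choose (t - i))"
    by (intro sum_mono local_bound)
  finally show ?thesis by (simp add: card_subsets_of_size)
qed

text \<open>A set of at least i points lies in at most one member of \<open>P\<close>. So all edges
  through a given i-set come from one r-set, which bounds the degree, and distinct members
  contribute distinct t-cliques because t >= i.\<close>

lemma packing_lower_bound:
  assumes i: "1 \<le> i" "i < s" "s \<le> t" "t \<le> r" "i \<le> n"
    and P: "P \<subseteq> subsets_of_size r {..<n}" "\<And>e f. e \<in> P \<Longrightarrow> f \<in> P \<Longrightarrow> e \<noteq> f \<Longrightarrow> card (e \<inter> f) < i"
  shows "\<exists>H. sgraph n s H \<and> Delta n i H \<le> (r - i) choose (s - i) \<and> card P * (r choose t) \<le> kt n s t H"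
proof -
  define H where "H = (\<Union>e\<in>P. subsets_of_size s e)"
  have P': "e \<subseteq> {..<n}" "card e = r" "finite e" if "e \<in> P" for e
    using that P(1) finite_subset[of e "{..<n}"] by (auto simp: subsets_of_size_def)
  have unique: "e = f" if "e \<in> P" "f \<in> P" "I \<subseteq> e" "I \<subseteq> f" "i \<le> card I" for e f I
  proof (rule ccontr)
    assume "e \<noteq> f"
    have "card I \<le> card (e \<inter> f)" using that P'(3) by (intro card_mono) auto
    then show False using P(2)[OF that(1,2) \<open>e \<noteq> f\<close>] that by simp
  qed
  have finP: "finite P" using P(1) finite_subsets_of_size finite_subset by blast
  have "sgraph n s H" using P' by (fastforce simp: sgraph_def H_def subsets_of_size_def)
  moreover have "Delta n i H \<le> (r - i) choose (s - i)"
  proof (rule Delta_le[OF i(5)])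
    fix I assume I: "I \<subseteq> {..<n}" "card I = i"
    show "deg H I \<le> (r - i) choose (s - i)"
    proof (cases "\<exists>e\<in>P. I \<subseteq> e")
      case True
      then obtain e where e: "e \<in> P" "I \<subseteq> e" by blast
      have "{S\<in>H. I \<subseteq> S} \<subseteq> {S\<in>subsets_of_size s e. I \<subseteq> S}"
      proof
        fix S assume "S \<in> {S\<in>H. I \<subseteq> S}"
        then obtain f where f: "f \<in> P" "S \<in> subsets_of_size s f" "I \<subseteq> S" by (auto simp: H_def)
        then have "I \<subseteq> f" by (auto simp: subsets_of_size_def)
        then have "e = f" using unique[OF e(1) f(1) e(2)] I by simp
        then show "S \<in> {S\<in>subsets_of_size s e. I \<subseteq> S}" using f by simp
      qed
      then have "deg H I \<le> card {S\<in>subsets_of_size s e. I \<subseteq> S}"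
        unfolding deg_def using P'(3)[OF e(1)] by (intro card_mono) (auto simp: finite_subsets_of_size)
      then show ?thesis using card_supersets_of_size[OF P'(3)[OF e(1)] e(2), of s] I i P'[OF e(1)] by simp
    next
      case False
      then have "{S\<in>H. I \<subseteq> S} = {}" by (force simp: H_def subsets_of_size_def)
      then show ?thesis by (simp only: deg_def card.empty le0)
    qed
  qed
  moreover have "card P * (r choose t) \<le> kt n s t H"
  proof -
    have "card (\<Union>e\<in>P. subsets_of_size t e) = (\<Sum>e\<in>P. card (subsets_of_size t e))"
    proof (rule card_UN_disjoint[OF finP])
      show "\<forall>e\<in>P. finite (subsets_of_size t e)" using P' finite_subsets_of_size by blast
      show "\<forall>e\<in>P. \<forall>f\<in>P. e \<noteq> f \<longrightarrow> subsets_of_size t e \<inter> subsets_of_size t f = {}"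
      proof (intro ballI impI equals0I)
        fix e f T assume ef: "e \<in> P" "f \<in> P" "e \<noteq> f" and "T \<in> subsets_of_size t e \<inter> subsets_of_size t f"
        then have "T \<subseteq> e" "T \<subseteq> f" "i \<le> card T" using i by (auto simp: subsets_of_size_def)
        then show False using unique ef by blast
      qed
    qed
    also have "\<dots> = (\<Sum>e\<in>P. r choose t)"
      using P' by (intro sum.cong refl) (simp add: card_subsets_of_size)
    finally have "card P * (r choose t) = card (\<Union>e\<in>P. subsets_of_size t e)" by simp
    also have "\<dots> \<le> kt n s t H"
      unfolding kt_def
    proof (rule card_mono)
      show "finite {T. T \<subseteq> {..<n} \<and> card T = t \<and> (\<forall>S. S \<subseteq> T \<and> card S = s \<longrightarrow> S \<in> H)}"
        by (rule finite_subset[of _ "Pow {..<n}"]) auto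
      show "(\<Union>e\<in>P. subsets_of_size t e) \<subseteq> {T. T \<subseteq> {..<n} \<and> card T = t \<and> (\<forall>S. S \<subseteq> T \<and> card S = s \<longrightarrow> S \<in> H)}"
      proof
        fix T assume "T \<in> (\<Union>e\<in>P. subsets_of_size t e)"
        then obtain e where e: "e \<in> P" "T \<subseteq> e" "card T = t" by (auto simp: subsets_of_size_def)
        have "S \<in> H" if "S \<subseteq> T" "card S = s" for S
          using that e unfolding H_def subsets_of_size_def by blast
        then show "T \<in> {T. T \<subseteq> {..<n} \<and> card T = t \<and> (\<forall>S. S \<subseteq> T \<and> card S = s \<longrightarrow> S \<in> H)}"
          using e P'(1)[OF e(1)] by auto
      qed
    qed
    finally show ?thesis .
  qed
  ultimately show ?thesis by blast
qed

lemma finite_kt_values: "finite {kt n s t H |H. sgraph n s H \<and> \<Phi> H}"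
proof (rule finite_surj)
  show "finite (Pow (Pow {..<n}))" by simp
  show "{kt n s t H |H. sgraph n s H \<and> \<Phi> H} \<subseteq> kt n s t ` Pow (Pow {..<n})"
    by (auto simp: sgraph_def)
qed

theorem mainTheorem16:
  fixes i s t r :: nat
  assumes "1 \<le> i" "i < s" "s \<le> t" "t \<le> r"
  shows "(\<lambda>n. real (Nmax i s t r n) /
            (real (n choose i) / real (r choose i) * real (r choose t))) \<longlonglongrightarrow> 1"
proof -
  note lower = packing_lower_bound[OF assms]
  define b where "b n = real (n choose i) / real (r choose i) * real (r choose t)" for n
  have b_pos: "b n > 0" if "n \<ge> r" for n using that assms by (simp add: b_def)
  have upper: "\<forall>\<^sub>F n in sequentially. real (Nmax i s t r n) / b n \<le> 1"
    using eventually_ge_at_top[of r]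
  proof eventually_elim
    case (elim n)
    \<comment> \<open>The empty packing shows that the maximum is over a nonempty set, hence
      attained.\<close>
    have "\<exists>H. sgraph n s H \<and> Delta n i H \<le> (r - i) choose (s - i) \<and> card {} * (r choose t) \<le> kt n s t H"
      using lower[of n "{}"] elim assms by simp
    then have "Nmax i s t r n \<in> {kt n s t H |H. sgraph n s H \<and> Delta n i H \<le> (r - i) choose (s - i)}"
      unfolding Nmax_def by (intro Max_in finite_kt_values) auto
    then obtain H where H: "Nmax i s t r n = kt n s t H" "sgraph n s H" "Delta n i H \<le> (r - i) choose (s - i)"
      by blast
    have "real (Nmax i s t r n) * (t choose i) \<le> real (n choose i) * ((r - i) choose (t - i))"
      using kt_upper_bound[OF assms H(2,3)] unfolding H(1) by (metis of_nat_le_iff of_nat_mult)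
    \<comment> \<open>Both sides count pairs of an i-set inside a t-set within an r-set; this turns
      the upper bound into \<open>b n\<close>.\<close>
    moreover have "real (r choose i) * ((r - i) choose (t - i)) = real (r choose t) * (t choose i)"
      using choose_mult[of i t r] assms by (metis less_imp_le of_nat_mult order.strict_trans2)
    then have "real ((r - i) choose (t - i)) = real (r choose t) * (t choose i) / (r choose i)"
      using assms by (simp add: field_simps)
    ultimately have "real (Nmax i s t r n) * (t choose i) \<le> b n * (t choose i)"
      by (simp add: b_def)
    then have "real (Nmax i s t r n) \<le> b n" using assms by simp
    then show ?case using b_pos[OF elim] by simp
  qed
  have lower: "\<forall>\<^sub>F n in sequentially. 1 - \<epsilon> \<le> real (Nmax i s t r n) / b n" if \<epsilon>: "\<epsilon> > 0" for \<epsilon>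
  proof -
    \<comment> \<open>Chosen so that 1 / C(r,i) - \<eta> = (1 - \<epsilon>) / C(r,i).\<close>
    define \<eta> where "\<eta> = \<epsilon> / (r choose i)"
    have ri: "real (r choose i) > 0" using assms by simp
    have \<eta>: "\<eta> > 0" using \<epsilon> ri by (simp add: \<eta>_def)
    have "i < r" using assms by simp
    from roedl_packing[OF assms(1) this \<eta>] eventually_ge_at_top[of r] show ?thesis
    proof eventually_elim
      case (elim n)
      then obtain P where P: "P \<subseteq> subsets_of_size r {..<n}"
        "\<forall>e\<in>P. \<forall>f\<in>P. e \<noteq> f \<longrightarrow> card (e \<inter> f) < i"
        "(1 / (r choose i) - \<eta>) * (n choose i) \<le> card P" by blast
      have "i \<le> n" using elim assms by simp
      from lower[OF this P(1)] P(2) obtain H where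
        H: "sgraph n s H" "Delta n i H \<le> (r - i) choose (s - i)" "card P * (r choose t) \<le> kt n s t H" by blast
      have "kt n s t H \<le> Nmax i s t r n"
        unfolding Nmax_def using H by (intro Max_ge finite_kt_values) auto
      then have "card P * (r choose t) \<le> Nmax i s t r n" using H(3) by linarith
      then have "real (card P) * (r choose t) \<le> Nmax i s t r n" by (metis of_nat_le_iff of_nat_mult)
      moreover have "(1 / (r choose i) - \<eta>) * (n choose i) * (r choose t) \<le> real (card P) * (r choose t)"
        using P(3) by (intro mult_right_mono) auto
      moreover have "(1 / (r choose i) - \<eta>) * (n choose i) * (r choose t) = (1 - \<epsilon>) * b n"
        using ri by (simp add: b_def \<eta>_def field_simps)
      ultimately have "(1 - \<epsilon>) * b n \<le> Nmax i s t r n" by linarith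
      then show ?case using b_pos elim by (simp add: pos_le_divide_eq)
    qed
  qed
  have "(\<lambda>n. real (Nmax i s t r n) / b n) \<longlonglongrightarrow> 1"
  proof (rule order_tendstoI)
    fix a :: real assume "a < 1"
    then have "\<forall>\<^sub>F n in sequentially. 1 - (1 - a) / 2 \<le> real (Nmax i s t r n) / b n"
      by (intro lower) simp
    then show "\<forall>\<^sub>F n in sequentially. a < real (Nmax i s t r n) / b n"
      by eventually_elim (use \<open>a < 1\<close> in \<open>simp add: field_simps\<close>)
  next
    fix a :: real assume "1 < a"
    from upper show "\<forall>\<^sub>F n in sequentially. real (Nmax i s t r n) / b n < a"
      by eventually_elim (use \<open>1 < a\<close> in linarith)
  qed
  then show ?thesis unfolding b_def .
qed

end
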